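(* Let $p=6$, let $(\mathcal G_\ell)_{\ell>0}$ be a family of compact connected metric graphs without terminal edges and without cycle coverings, whose longest bridging edge has variable length $\ell$, the remaining part of the graph being fixed in the sense specified in the context, and write $\mu_1=\mu_1(\mathcal G_\ell,6)$, $\mu_{\mathbb R}=\frac{\pi\sqrt3}{2}$. If $\ell$ is large enough, then there exists a whole (nonempty) interval of masses $\mu\in(\mu_1,\mu_{\mathbb R}]$ such that the ground states of mass $\mu$ are not constant on $\mathcal G_\ell$; that is, $\mu_1<\mu_{\mathbb R}$ and for every $\mu\in(\mu_1,\mu_{\mathbb R}]$ the ground states of $E$ in $H^1_\mu(\mathcal G_\ell)$ are nonconstant.
   Context: A compact metric graph $\mathcal G$ is formed by finitely many edges (bounded intervals $I_e=[0,\ell_e]$, $0<\ell_e<\infty$) with some endpoints glued together at vertices; self-loops and multiple edges are allowed. All graphs are connected. $|\mathcal G|=\sum_e\ell_e$ is the total length. Integrals and $L^p(\mathcal G)$ norms $\|\cdot\|_p$ are defined edge by edge with Lebesgue measure. $H^1(\mathcal G)$ is the space of continuous $u:\mathcal G\to\mathbb C$ whose restriction $u_e$ to each edge is in $H^1(I_e)$. For $\mu>0$, $H^1_\mu(\mathcal G)=\{u\in H^1(\mathcal G):\|u\|_2^2=\mu\}$. A terminal edge is an edge ending at a vertex of degree 1. $\mathcal G$ admits a cycle covering if it can be covered by cycles, a cycle being a closed path (loop) without edge repetitions. A bridging edge is an edge whose removal disconnects the graph into two disjoint components. A graph with no terminal edge and no cycle covering has at least one bridging edge. The family $\mathcal G_\ell$: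 the underlying combinatorial graph (with no terminal edge and no cycle covering) is the same for all $\ell$; the lengths of all non-bridging edges are fixed, independent of $\ell$; a distinguished bridging edge has length $\ell$; all other bridging edges (if any) have length at most $\ell$ and bounded uniformly in $\ell$. (If there is exactly one bridging edge, this means $\mathcal G_\ell$ consists of two fixed compact graphs $\Gamma_1,\Gamma_2$, independent of $\ell$, joined by an edge of length $\ell$.) Let $E(u)=\frac12\|u'\|_2^2-\frac16\|u\|_6^6$ and $\kappa_\mu=\sqrt{\mu/|\mathcal G|}$ (constant function). A ground state of mass $\mu$ is a global minimizer of $E$ in $H^1_\mu(\mathcal G)$; it is known that, for $p=6$ and a compact graph without terminal edges, ground states of mass $\mu$ exist if and only if $\mu\le\mu_{\mathbb R}$. $\mu_1(\mathcal G,6)>0$ denotes the threshold mass for local minimality of the constants: $\kappa_\mu$ is a local minimizer (in the $H^1$ topology) of $E$ in $H^1_\mu(\mathcal G)$ for $\mu<\mu_1(\mathcal G,6)$, and is not for $\mu>\mu_1(\mathcal G,6)$. In the paper it is defined explicitly by $\mu_1(\mathcal G,6)=|\mathcal G|\left(\lambda_2(\mathcal G)/4\right)^{1/2}$, where $\lambda_2(\mathcal G)=\inf\{\int_{\mathcal G}|\varphi'|^2dx/\int_{\mathcal G}|\varphi|^2dx:\ \varphi\in H^1(\mathcal G)\setminus\{0\},\ \int_{\mathcal G}\varphi\,dx=0\}$. *)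

theory Defs
  imports "HOL-Analysis.Analysis" "Graph_Theory.Graph_Theory"
begin

section \<open>The combinatorial graph\<close>

text \<open>
  A finite undirected multigraph (self-loops and multiple edges allowed) is represented by a
  digraph in the sense of \<^locale>\<open>fin_digraph\<close>: the direction of an arc \<open>e\<close> only fixes the
  parametrisation of the edge \<open>e\<close>, whose endpoints \<open>0\<close> and \<open>\<ell>\<^sub>e\<close> are glued to \<open>tail G e\<close> and
  \<open>head G e\<close>. The predicate \<^const>\<open>Digraph_Component.connected\<close> ignores directions.
\<close>

definition vertex_degree :: "('v, 'e) pre_digraph \<Rightarrow> 'v \<Rightarrow> nat" where
  "vertex_degree G v = in_degree G v + out_degree G v"

definition terminal_edge :: "('v, 'e) pre_digraph \<Rightarrow> 'e \<Rightarrow> bool" where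
  "terminal_edge G e \<longleftrightarrow>
     e \<in> arcs G \<and> (vertex_degree G (tail G e) = 1 \<or> vertex_degree G (head G e) = 1)"

text \<open>Every edge may be traversed in both directions: \<open>(e, True)\<close> is \<open>e\<close> from tail to head,
  \<open>(e, False)\<close> is \<open>e\<close> from head to tail.\<close>

definition bidirected :: "('v, 'e) pre_digraph \<Rightarrow> ('v, 'e \<times> bool) pre_digraph" where
  "bidirected G = \<lparr> verts = verts G, arcs = arcs G \<times> UNIV,
     tail = (\<lambda>(e, b). if b then tail G e else head G e),
     head = (\<lambda>(e, b). if b then head G e else tail G e) \<rparr>"

text \<open>Closed paths in which no edge is repeated (in either direction); vertices may be repeated.\<close>

definition graph_cycle :: "('v, 'e) pre_digraph \<Rightarrow> ('e \<times> bool) list \<Rightarrow> bool" where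
  "graph_cycle G p \<longleftrightarrow>
     p \<noteq> [] \<and> (\<exists>v. pre_digraph.awalk (bidirected G) v p v) \<and> distinct (map fst p)"

definition has_cycle_covering :: "('v, 'e) pre_digraph \<Rightarrow> bool" where
  "has_cycle_covering G \<longleftrightarrow> (\<forall>e\<in>arcs G. \<exists>p. graph_cycle G p \<and> e \<in> set (map fst p))"

definition bridging_edge :: "('v, 'e) pre_digraph \<Rightarrow> 'e \<Rightarrow> bool" where
  "bridging_edge G e \<longleftrightarrow>
     e \<in> arcs G \<and> \<not> Digraph_Component.connected (pre_digraph.del_arc G e)"

section \<open>Sobolev functions on a bounded interval\<close>

definition L2_interval :: "real \<Rightarrow> (real \<Rightarrow> complex) \<Rightarrow> bool" where
  "L2_interval l g \<longleftrightarrow> g \<in> borel_measurable (lebesgue_on {0..l}) \<and>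
     integrable (lebesgue_on {0..l}) (\<lambda>x. (norm (g x))\<^sup>2)"

text \<open>Test functions: \<open>C\<^sup>1\<close> with compact support in the open interval.\<close>

definition test_function :: "real \<Rightarrow> (real \<Rightarrow> real) \<Rightarrow> bool" where
  "test_function l \<phi> \<longleftrightarrow> \<phi> C1_differentiable_on UNIV \<and> closure {x. \<phi> x \<noteq> 0} \<subseteq> {0<..<l}"

definition weak_derivative :: "real \<Rightarrow> (real \<Rightarrow> complex) \<Rightarrow> (real \<Rightarrow> complex) \<Rightarrow> bool" where
  "weak_derivative l u g \<longleftrightarrow> (\<forall>\<phi>. test_function l \<phi> \<longrightarrow>
     (LINT x|lebesgue_on {0..l}. deriv \<phi> x *\<^sub>R u x) = - (LINT x|lebesgue_on {0..l}. \<phi> x *\<^sub>R g x))"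

definition H1_interval :: "real \<Rightarrow> (real \<Rightarrow> complex) \<Rightarrow> bool" where
  "H1_interval l u \<longleftrightarrow> L2_interval l u \<and> (\<exists>g. L2_interval l g \<and> weak_derivative l u g)"

section \<open>Functions on a compact metric graph\<close>

text \<open>
  A metric graph is a pair of a graph \<open>G\<close> and an edge length function \<open>L\<close>. A function \<open>u\<close> on it is
  given edge by edge: \<open>u e x\<close> for \<open>e \<in> arcs G\<close> and \<open>x \<in> {0..L e}\<close>; other values are irrelevant.
  Continuity on the graph means continuity on every closed edge together with the existence of a
  value \<open>f v\<close> at each vertex \<open>v\<close>, shared by all edge ends glued at \<open>v\<close>.
\<close>

definition total_length :: "('v, 'e) pre_digraph \<Rightarrow> ('e \<Rightarrow> real) \<Rightarrow> real" where
  "total_length G L = (\<Sum>e\<in>arcs G. L e)"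

definition graph_integral ::
  "('v, 'e) pre_digraph \<Rightarrow> ('e \<Rightarrow> real) \<Rightarrow> ('e \<Rightarrow> real \<Rightarrow> 'b) \<Rightarrow> 'b::{banach, second_countable_topology}"
where
  "graph_integral G L u = (\<Sum>e\<in>arcs G. LINT x|lebesgue_on {0..L e}. u e x)"

definition Lp_norm ::
  "('v, 'e) pre_digraph \<Rightarrow> ('e \<Rightarrow> real) \<Rightarrow> nat \<Rightarrow> ('e \<Rightarrow> real \<Rightarrow> complex) \<Rightarrow> real" where
  "Lp_norm G L p u = root p (graph_integral G L (\<lambda>e x. (norm (u e x)) ^ p))"

definition graph_continuous ::
  "('v, 'e) pre_digraph \<Rightarrow> ('e \<Rightarrow> real) \<Rightarrow> ('e \<Rightarrow> real \<Rightarrow> complex) \<Rightarrow> bool" where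
  "graph_continuous G L u \<longleftrightarrow> (\<forall>e\<in>arcs G. continuous_on {0..L e} (u e)) \<and>
     (\<exists>f. \<forall>e\<in>arcs G. u e 0 = f (tail G e) \<and> u e (L e) = f (head G e))"

definition H1 ::
  "('v, 'e) pre_digraph \<Rightarrow> ('e \<Rightarrow> real) \<Rightarrow> ('e \<Rightarrow> real \<Rightarrow> complex) set" where
  "H1 G L = {u. graph_continuous G L u \<and> (\<forall>e\<in>arcs G. H1_interval (L e) (u e))}"

text \<open>The \<open>L\<^sup>2\<close> weak derivative on each edge; it is determined up to null sets.\<close>

definition graph_deriv :: "('e \<Rightarrow> real) \<Rightarrow> ('e \<Rightarrow> real \<Rightarrow> complex) \<Rightarrow> 'e \<Rightarrow> real \<Rightarrow> complex" where
  "graph_deriv L u e = (SOME g. L2_interval (L e) g \<and> weak_derivative (L e) (u e) g)"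

definition H1_mass ::
  "('v, 'e) pre_digraph \<Rightarrow> ('e \<Rightarrow> real) \<Rightarrow> real \<Rightarrow> ('e \<Rightarrow> real \<Rightarrow> complex) set" where
  "H1_mass G L \<mu> = {u \<in> H1 G L. (Lp_norm G L 2 u)\<^sup>2 = \<mu>}"

definition energy ::
  "('v, 'e) pre_digraph \<Rightarrow> ('e \<Rightarrow> real) \<Rightarrow> ('e \<Rightarrow> real \<Rightarrow> complex) \<Rightarrow> real" where
  "energy G L u = 1/2 * (Lp_norm G L 2 (graph_deriv L u))\<^sup>2 - 1/6 * (Lp_norm G L 6 u) ^ 6"

definition ground_state ::
  "('v, 'e) pre_digraph \<Rightarrow> ('e \<Rightarrow> real) \<Rightarrow> real \<Rightarrow> ('e \<Rightarrow> real \<Rightarrow> complex) \<Rightarrow> bool" where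
  "ground_state G L \<mu> u \<longleftrightarrow>
     u \<in> H1_mass G L \<mu> \<and> (\<forall>v\<in>H1_mass G L \<mu>. energy G L u \<le> energy G L v)"

definition constant_on_graph ::
  "('v, 'e) pre_digraph \<Rightarrow> ('e \<Rightarrow> real) \<Rightarrow> ('e \<Rightarrow> real \<Rightarrow> complex) \<Rightarrow> bool" where
  "constant_on_graph G L u \<longleftrightarrow> (\<exists>c. \<forall>e\<in>arcs G. \<forall>x\<in>{0..L e}. u e x = c)"

section \<open>Threshold masses\<close>

definition lambda2 :: "('v, 'e) pre_digraph \<Rightarrow> ('e \<Rightarrow> real) \<Rightarrow> real" where
  "lambda2 G L = Inf {graph_integral G L (\<lambda>e x. (norm (graph_deriv L \<phi> e x))\<^sup>2) /
                      graph_integral G L (\<lambda>e x. (norm (\<phi> e x))\<^sup>2) | \<phi>.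
     \<phi> \<in> H1 G L \<and> (\<exists>e\<in>arcs G. \<exists>x\<in>{0..L e}. \<phi> e x \<noteq> 0) \<and> graph_integral G L \<phi> = 0}"

definition mu1 :: "('v, 'e) pre_digraph \<Rightarrow> ('e \<Rightarrow> real) \<Rightarrow> real" where
  "mu1 G L = total_length G L * sqrt (lambda2 G L / 4)"

definition mu_R :: real where
  "mu_R = pi * sqrt 3 / 2"

end

theory Submission
  imports Defs
begin

text \<open>
  Two facts are combined: a lengthening bridge keeps \<^const>\<open>mu1\<close> below \<^const>\<open>mu_R\<close>, and above
  \<^const>\<open>mu1\<close> no constant function minimises the energy.

  Removing the bridge \<open>b\<close> of length \<open>l\<close> splits the vertices into two classes, with \<open>b\<close> the only edge
  between them (\<open>bridge_separation\<close>). The function equal to \<open>1\<close> on one side and \<open>-1\<close> on the other,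
  linear along \<open>b\<close>, and shifted by a constant to have mean zero, has Dirichlet integral \<open>4 / l\<close>. The
  shift can only increase the integral of the square over \<open>b\<close>, which is at least \<open>l / 3\<close>. Hence
  \<open>lambda2 \<le> 12 / l\<^sup>2\<close> (\<open>bridge_rayleigh_quotient\<close>) and \<open>mu1 \<le> sqrt 3 * |G| / l\<close>
  (\<open>mu1_le_bridge\<close>). The total length exceeds \<open>l\<close> by a bounded amount, so the bound tends to
  \<open>sqrt 3 < pi * sqrt 3 / 2 = mu_R\<close>.

  If \<open>\<mu> > mu1\<close> and \<open>\<kappa>\<^sup>2 = \<mu> / |G|\<close>, then \<open>lambda2 < 4 * \<kappa>^4\<close>, so some \<open>\<phi>\<close> of mean zero satisfies
  \<open>\<integral>|\<phi>'|\<^sup>2 < 4 * \<kappa>^4 * \<integral>|\<phi>|\<^sup>2\<close>; its real or its imaginary part \<open>w\<close> does too, and changing the sign of \<open>w\<close>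
  gives \<open>\<integral>w\<^sup>3 \<ge> 0\<close> (\<open>real_part_reduction\<close>). The competitor \<open>s * (\<kappa> + \<epsilon> * w)\<close>, with \<open>s\<close> normalising
  its mass to \<open>\<mu>\<close>, has smaller energy than the constant once \<open>\<epsilon>\<close> is small
  (\<open>energy_below_constant\<close>). No Taylor remainder has to be estimated: the terms of degree at least
  four in the expansion of the sixth power add up to something nonnegative
  (\<open>sixth_power_lower_bound\<close>), and the cubic term is nonnegative by the choice of sign.

  Since \<^const>\<open>graph_deriv\<close> picks an arbitrary weak derivative, computing an energy requires uniqueness
  of weak derivatives up to null sets (\<open>weak_derivative_unique\<close>), that is, the fundamental lemma
  of the calculus of variations.
\<close>

section \<open>Integrals over a bounded interval\<close>

lemma integrable_of_L2_interval:
  assumes "L2_interval l g"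
  shows "integrable (lebesgue_on {0..l}) g"
proof -
  have m: "g \<in> borel_measurable (lebesgue_on {0..l})"
    and i: "integrable (lebesgue_on {0..l}) (\<lambda>x. (norm (g x))\<^sup>2)"
    using assms by (auto simp: L2_interval_def)
  have "integrable (lebesgue_on {0..l}) (\<lambda>x. 1 + (norm (g x))\<^sup>2)"
    by (intro Bochner_Integration.integrable_add i continuous_imp_integrable_real continuous_intros)
  then show ?thesis
  proof (rule Bochner_Integration.integrable_bound[OF _ m])
    have "norm (g x) \<le> 1 + (norm (g x))\<^sup>2" for x
      using zero_le_power2[of "norm (g x) - 1/2"] by (simp add: power2_eq_square algebra_simps)
    then show "AE x in lebesgue_on {0..l}. norm (g x) \<le> norm (1 + (norm (g x))\<^sup>2)"
      by (intro AE_I2) (metis abs_ge_self order_trans real_norm_def)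
  qed
qed

lemma L2_interval_continuous:
  assumes "continuous_on {0..l} g"
  shows "L2_interval l g"
  unfolding L2_interval_def
  by (intro conjI borel_measurable_integrable continuous_imp_integrable_real continuous_on_power
      continuous_on_norm assms)

lemma L2_interval_linear_image:
  assumes T: "bounded_linear T" and g: "L2_interval l g"
  shows "L2_interval l (\<lambda>x. T (g x))"
proof -
  obtain K where K: "\<And>z. norm (T z) \<le> norm z * K" using bounded_linear.bounded[OF T] by blast
  have m: "(\<lambda>x. T (g x)) \<in> borel_measurable (lebesgue_on {0..l})"
    by (rule borel_measurable_integrable[OF integrable_bounded_linear[OF T integrable_of_L2_interval[OF g]]])
  moreover have "integrable (lebesgue_on {0..l}) (\<lambda>x. (norm (T (g x)))\<^sup>2)"
  proof (rule Bochner_Integration.integrable_bound)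
    show "integrable (lebesgue_on {0..l}) (\<lambda>x. K\<^sup>2 * (norm (g x))\<^sup>2)"
      using g by (simp add: L2_interval_def)
    show "(\<lambda>x. (norm (T (g x)))\<^sup>2) \<in> borel_measurable (lebesgue_on {0..l})" using m by measurable
    have "(norm (T z))\<^sup>2 \<le> K\<^sup>2 * (norm z)\<^sup>2" for z
      using power_mono[OF K, of z 2] by (simp add: power_mult_distrib mult.commute)
    then show "AE x in lebesgue_on {0..l}. norm ((norm (T (g x)))\<^sup>2) \<le> norm (K\<^sup>2 * (norm (g x))\<^sup>2)"
      by (intro AE_I2) (simp add: abs_mult)
  qed
  ultimately show ?thesis by (simp add: L2_interval_def)
qed

lemma integral_lebesgue_on_FTC:
  fixes f :: "real \<Rightarrow> 'b::euclidean_space"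
  assumes "0 \<le> l" and c: "continuous_on {0..l} f"
    and "\<And>x. (F has_vector_derivative f x) (at x within {0..l})"
  shows "(LINT x|lebesgue_on {0..l}. f x) = F l - F 0"
proof -
  have "(f has_integral F l - F 0) {0..l}"
    using assms by (intro fundamental_theorem_of_calculus) auto
  then show ?thesis
    by (subst lebesgue_integral_eq_integral[OF continuous_imp_integrable_real[OF c]])
      (auto simp: integral_unique)
qed

lemma integral_lebesgue_on_const:
  fixes c :: "'b::euclidean_space"
  assumes "0 \<le> l"
  shows "(LINT x|lebesgue_on {0..l}. c) = l *\<^sub>R c"
  using assms
  by (subst lebesgue_integral_eq_integral) (auto intro!: continuous_imp_integrable_real)

lemma integral_lebesgue_on_affine:
  fixes \<alpha> \<beta> :: complex
  assumes "0 \<le> l"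
  shows "(LINT x|lebesgue_on {0..l}. \<alpha> + x *\<^sub>R \<beta>) = l *\<^sub>R \<alpha> + (l\<^sup>2 / 2) *\<^sub>R \<beta>"
proof -
  have "((\<lambda>x. x *\<^sub>R \<alpha> + (x\<^sup>2 / 2) *\<^sub>R \<beta>) has_vector_derivative \<alpha> + x *\<^sub>R \<beta>) (at x within {0..l})" for x
  proof -
    have "((\<lambda>x. x\<^sup>2 / 2) has_real_derivative x) (at x within {0..l})"
      by (auto intro!: derivative_eq_intros)
    from has_vector_derivative_add[OF
        has_vector_derivative_scaleR[OF DERIV_ident has_vector_derivative_const]
        has_vector_derivative_scaleR[OF this has_vector_derivative_const]]
    show ?thesis by simp
  qed
  then have "(LINT x|lebesgue_on {0..l}. \<alpha> + x *\<^sub>R \<beta>)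
      = (l *\<^sub>R \<alpha> + (l\<^sup>2 / 2) *\<^sub>R \<beta>) - (0 *\<^sub>R \<alpha> + (0\<^sup>2 / 2) *\<^sub>R \<beta>)"
    by (intro integral_lebesgue_on_FTC assms continuous_intros)
  then show ?thesis by simp
qed

lemma integral_lebesgue_on_affine_squared:
  fixes p q :: real
  assumes "0 \<le> l"
  shows "(LINT x|lebesgue_on {0..l}. (p + q * x)\<^sup>2) = p\<^sup>2 * l + p * q * l\<^sup>2 + q\<^sup>2 * l ^ 3 / 3"
proof -
  have "((\<lambda>x. p\<^sup>2 * x + p * q * x\<^sup>2 + q\<^sup>2 * x ^ 3 / 3) has_real_derivative (p + q * x)\<^sup>2) (at x within {0..l})" for x
    by (auto intro!: derivative_eq_intros simp: power2_eq_square algebra_simps)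
  then have "(LINT x|lebesgue_on {0..l}. (p + q * x)\<^sup>2)
      = (p\<^sup>2 * l + p * q * l\<^sup>2 + q\<^sup>2 * l ^ 3 / 3) - (p\<^sup>2 * 0 + p * q * 0\<^sup>2 + q\<^sup>2 * 0 ^ 3 / 3)"
    unfolding has_real_derivative_iff_has_vector_derivative
    by (intro integral_lebesgue_on_FTC assms continuous_intros)
  then show ?thesis by simp
qed

section \<open>The fundamental lemma of the calculus of variations\<close>

lemma test_functionD:
  assumes "test_function l \<phi>"
  shows "(\<phi> has_real_derivative deriv \<phi> x) (at x)"
    and "continuous_on S (deriv \<phi>)" and "continuous_on S \<phi>" and "\<phi> 0 = 0" and "\<phi> l = 0"
proof -
  obtain D where D: "\<And>x. (\<phi> has_vector_derivative D x) (at x)" "continuous_on UNIV D"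
    using assms by (auto simp: test_function_def C1_differentiable_on_def)
  have D': "(\<phi> has_real_derivative D x) (at x)" for x
    using D(1) by (simp add: has_real_derivative_iff_has_vector_derivative)
  then have D_eq: "deriv \<phi> = D" by (intro ext DERIV_imp_deriv)
  show "(\<phi> has_real_derivative deriv \<phi> x) (at x)"
    unfolding D_eq by (rule D')
  show "continuous_on S (deriv \<phi>)"
    unfolding D_eq by (rule continuous_on_subset[OF D(2)]) simp
  show "continuous_on S \<phi>"
    by (intro continuous_at_imp_continuous_on ballI DERIV_isCont[OF D'])
  have "{x. \<phi> x \<noteq> 0} \<subseteq> {0<..<l}"
    using assms order_trans[OF closure_subset] unfolding test_function_def by blast
  then show "\<phi> 0 = 0" "\<phi> l = 0" by auto
qed

lemma has_real_derivative_max_squared: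
  "((\<lambda>x. (max 0 x)\<^sup>2) has_real_derivative 2 * max 0 x) (at (x::real))"
proof -
  consider "x > 0" | "x < 0" | "x = 0" by linarith
  then show ?thesis
  proof cases
    case 1
    have "((\<lambda>x. x\<^sup>2) has_real_derivative 2 * max 0 x) (at x)"
      using 1 by (auto intro!: derivative_eq_intros)
    moreover have "\<forall>\<^sub>F y in nhds x. (max 0 y)\<^sup>2 = y\<^sup>2"
      by (rule eventually_mono[OF eventually_nhds_in_open[of "{0<..}" x]]) (use 1 in auto)
    ultimately show ?thesis by (subst DERIV_cong_ev[OF refl _ refl])
  next
    case 2
    have "((\<lambda>x. 0) has_real_derivative 2 * max 0 x) (at x)"
      using 2 by (auto intro!: derivative_eq_intros)
    moreover have "\<forall>\<^sub>F y in nhds x. (max 0 y)\<^sup>2 = 0"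
      by (rule eventually_mono[OF eventually_nhds_in_open[of "{..<0}" x]]) (use 2 in auto)
    ultimately show ?thesis by (subst DERIV_cong_ev[OF refl _ refl])
  next
    case 3
    have "((\<lambda>h. (max 0 h)\<^sup>2 / h) \<longlongrightarrow> 0) (at (0::real))"
    proof (rule Lim_null_comparison)
      show "\<forall>\<^sub>F h in at 0. norm ((max 0 h)\<^sup>2 / h) \<le> \<bar>h::real\<bar>"
        by (intro always_eventually allI) (auto simp: max_def power2_eq_square)
      show "((\<lambda>h. \<bar>h::real\<bar>) \<longlongrightarrow> 0) (at 0)"
        by (auto intro: tendsto_eq_intros)
    qed
    then show ?thesis using 3 by (simp add: DERIV_def)
  qed
qed

text \<open>
  The indicator of an interval is a bounded pointwise limit of test functions \<open>n p / (1 + n p)\<close>,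
  where \<open>p\<close> is a nonnegative \<open>C\<^sup>1\<close> function vanishing exactly outside the interval.
\<close>

lemma test_functions_tendsto_indicator:
  assumes "0 < a" "a < b" "b < l"
  obtains \<phi> :: "nat \<Rightarrow> real \<Rightarrow> real" where "\<And>n. test_function l (\<phi> n)"
    and "\<And>n x. \<bar>\<phi> n x\<bar> \<le> 1" and "\<And>x. (\<lambda>n. \<phi> n x) \<longlonglongrightarrow> indicator {a<..<b} x"
proof -
  define p where "p = (\<lambda>x::real. (max 0 (x - a))\<^sup>2 * (max 0 (b - x))\<^sup>2)"
  define p' where "p' = (\<lambda>x::real. 2 * max 0 (x - a) * (max 0 (b - x))\<^sup>2 - (max 0 (x - a))\<^sup>2 * (2 * max 0 (b - x)))"
  define \<phi> where "\<phi> = (\<lambda>n x. real n * p x / (1 + real n * p x))"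
  have p0: "p x \<ge> 0" for x by (simp add: p_def)
  then have pos: "1 + real n * p x > 0" for n x
    by (smt (verit) mult_nonneg_nonneg of_nat_0_le_iff)
  have "((\<lambda>x. (max 0 (x - a))\<^sup>2) has_real_derivative 2 * max 0 (x - a)) (at x)" for x
    using DERIV_chain'[where f="\<lambda>x. x - a" and D=1, OF _ has_real_derivative_max_squared[of "x - a"]]
    by (simp add: DERIV_diff[where E=0, OF DERIV_ident DERIV_const, simplified])
  moreover have "((\<lambda>x. (max 0 (b - x))\<^sup>2) has_real_derivative - (2 * max 0 (b - x))) (at x)" for x
    using DERIV_chain'[where f="\<lambda>x. b - x" and D="-1", OF _ has_real_derivative_max_squared[of "b - x"]]
    by (simp add: DERIV_diff[where D=0, OF DERIV_const DERIV_ident, simplified])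
  ultimately have dp: "(p has_real_derivative p' x) (at x)" for x
    unfolding p_def p'_def by - (rule DERIV_cong[OF DERIV_mult], assumption+, simp)
  have d\<phi>: "(\<phi> n has_real_derivative real n * p' x / (1 + real n * p x)\<^sup>2) (at x)" for n x
    unfolding \<phi>_def using pos[of n x]
    by (auto intro!: derivative_eq_intros dp simp: power2_eq_square divide_simps) (simp add: algebra_simps)
  have cp: "continuous_on UNIV p" "continuous_on UNIV p'"
    unfolding p_def p'_def by (intro continuous_intros)+
  have "\<phi> n C1_differentiable_on UNIV" for n
    unfolding C1_differentiable_on_def
  proof (intro exI[of _ "\<lambda>x. real n * p' x / (1 + real n * p x)\<^sup>2"] conjI ballI)
    show "(\<phi> n has_vector_derivative real n * p' x / (1 + real n * p x)\<^sup>2) (at x)" for x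
      using d\<phi> by (simp add: has_real_derivative_iff_has_vector_derivative)
    show "continuous_on UNIV (\<lambda>x. real n * p' x / (1 + real n * p x)\<^sup>2)"
      using pos[of n] by (intro continuous_intros cp) (auto simp: less_imp_neq[symmetric])
  qed
  moreover have "closure {x. \<phi> n x \<noteq> 0} \<subseteq> {0<..<l}" for n
  proof -
    have "{x. \<phi> n x \<noteq> 0} \<subseteq> {a..b}" by (auto simp: \<phi>_def p_def max_def split: if_splits)
    then have "closure {x. \<phi> n x \<noteq> 0} \<subseteq> {a..b}" by (simp add: closure_minimal)
    also have "\<dots> \<subseteq> {0<..<l}" using assms by auto
    finally show ?thesis .
  qed
  ultimately have "test_function l (\<phi> n)" for n by (simp add: test_function_def)
  moreover have "\<bar>\<phi> n x\<bar> \<le> 1" for n x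
    using pos[of n x] p0[of x] by (simp add: \<phi>_def)
  moreover have "(\<lambda>n. \<phi> n x) \<longlonglongrightarrow> indicator {a<..<b} x" for x
  proof (cases "x \<in> {a<..<b}")
    case True
    then have "p x > 0" by (simp add: p_def)
    have "filterlim (\<lambda>n. 1 + real n * p x) at_top sequentially"
      by (rule filterlim_tendsto_add_at_top[OF tendsto_const
            filterlim_at_top_mult_tendsto_pos[OF tendsto_const \<open>p x > 0\<close> filterlim_real_sequentially]])
    then have "(\<lambda>n. 1 - inverse (1 + real n * p x)) \<longlonglongrightarrow> 1 - 0"
      by (rule tendsto_diff[OF tendsto_const tendsto_inverse_0_at_top])
    moreover have "1 - inverse (1 + real n * p x) = \<phi> n x" for n
      using pos[of n x] by (simp add: \<phi>_def field_simps)
    ultimately show ?thesis using True by simp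
  next
    case False
    then have "p x = 0" by (auto simp: p_def max_def)
    then show ?thesis using False by (simp add: \<phi>_def)
  qed
  ultimately show thesis by (rule that)
qed

text \<open>
  Approximating indicators by test functions shows that the integral of \<open>h\<close> over every compact
  subinterval of the open interval vanishes; almost every value of \<open>h\<close> is a limit of means over
  such subintervals.
\<close>

lemma fundamental_lemma_calculus_of_variations:
  fixes h :: "real \<Rightarrow> complex"
  assumes h: "integrable (lebesgue_on {0..l}) h"
    and ortho: "\<And>\<phi>. test_function l \<phi> \<Longrightarrow> (LINT x|lebesgue_on {0..l}. \<phi> x *\<^sub>R h x) = 0"
  shows "AE x in lebesgue_on {0..l}. h x = 0"
proof -
  \<comment> \<open>Extension by zero, as the differentiation theorem below is for functions on the whole line.\<close>
  define f where "f = (\<lambda>x. if x \<in> {0..l} then h x else 0)"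
  have "f absolutely_integrable_on UNIV"
    using h unfolding f_def absolutely_integrable_restrict_UNIV
    by (simp add: set_integrable_def integrable_restrict_space)
  then have fint: "f integrable_on cbox a b" for a b
    by (metis absolutely_integrable_on_def integrable_on_subcbox subset_UNIV)
  have zero: "integral {a..b} f = 0" if ab: "0 < a" "a < b" "b < l" for a b
  proof -
    obtain \<phi> where \<phi>: "\<And>n. test_function l (\<phi> n)" "\<And>n x. \<bar>\<phi> n x\<bar> \<le> 1"
      "\<And>x. (\<lambda>n. \<phi> n x) \<longlonglongrightarrow> indicator {a<..<b} x"
      using test_functions_tendsto_indicator[OF ab] by blast
    have meas: "h \<in> borel_measurable (lebesgue_on {0..l})" using h by (rule borel_measurable_integrable)
    have "(\<lambda>n. LINT x|lebesgue_on {0..l}. \<phi> n x *\<^sub>R h x)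
        \<longlonglongrightarrow> (LINT x|lebesgue_on {0..l}. indicator {a<..<b} x *\<^sub>R h x)"
    proof (rule integral_dominated_convergence[where w="\<lambda>x. norm (h x)"])
      show "(\<lambda>x. indicator {a<..<b} x *\<^sub>R h x) \<in> borel_measurable (lebesgue_on {0..l})"
        by (intro borel_measurable_scaleR meas borel_measurable_indicator)
          (use ab in \<open>auto simp: sets_restrict_space image_iff intro!: bexI[of _ "{a<..<b}"]\<close>)
      show "(\<lambda>x. \<phi> n x *\<^sub>R h x) \<in> borel_measurable (lebesgue_on {0..l})" for n
        using test_functionD(3)[OF \<phi>(1)]
        by (intro borel_measurable_scaleR meas borel_measurable_integrable continuous_imp_integrable_real)
      show "AE x in lebesgue_on {0..l}. norm (\<phi> n x *\<^sub>R h x) \<le> norm (h x)" for n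
        using \<phi>(2) by (auto intro!: AE_I2 mult_left_le_one_le)
      show "AE x in lebesgue_on {0..l}. (\<lambda>n. \<phi> n x *\<^sub>R h x) \<longlonglongrightarrow> indicator {a<..<b} x *\<^sub>R h x"
        by (auto intro!: AE_I2 tendsto_intros \<phi>(3))
      show "integrable (lebesgue_on {0..l}) (\<lambda>x. norm (h x))" using h by simp
    qed
    then have "(LINT x|lebesgue_on {0..l}. indicator {a<..<b} x *\<^sub>R h x) = 0"
      using ortho[OF \<phi>(1)] by (simp add: LIMSEQ_const_iff)
    also have "(LINT x|lebesgue_on {0..l}. indicator {a<..<b} x *\<^sub>R h x)
        = (LINT x|lebesgue. indicator {a<..<b} x *\<^sub>R f x)"
      using ab by (subst integral_restrict_space)
        (auto simp: f_def indicator_def intro!: Bochner_Integration.integral_cong)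
    also have "\<dots> = integral {a<..<b} f"
    proof -
      have "f absolutely_integrable_on {a<..<b}"
        using \<open>f absolutely_integrable_on UNIV\<close> by (rule set_integrable_subset) auto
      then show ?thesis
        using set_lebesgue_integral_eq_integral(2) by (force simp: set_lebesgue_integral_def)
    qed
    finally show ?thesis by (simp add: integral_open_interval_real)
  qed
  obtain N where N: "negligible N"
    and lim: "\<And>x e. \<lbrakk>x \<notin> N; 0 < e\<rbrakk> \<Longrightarrow> \<exists>d>0. \<forall>t. 0 < t \<and> t < d \<longrightarrow>
                norm (integral (cbox x (x + t *\<^sub>R One)) f /\<^sub>R t ^ DIM(real) - f x) < e"
    using integrable_ccontinuous_explicit[OF fint] by metis
  have f0: "h x = 0" if x: "x \<notin> N \<union> {0, l}" "x \<in> {0..l}" for x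
  proof (rule ccontr)
    assume "h x \<noteq> 0"
    then obtain d where "d > 0"
      and d: "\<And>t. 0 < t \<Longrightarrow> t < d \<Longrightarrow> norm (integral {x..x + t} f /\<^sub>R t - f x) < norm (h x)"
      using lim[of x "norm (h x)"] x by auto
    \<comment> \<open>Half the minimum keeps \<open>x + t\<close> strictly below both \<open>x + d\<close> and \<open>l\<close>.\<close>
    define t where "t = min d (l - x) / 2"
    have t: "0 < t" "t < d" "x + t < l" using \<open>d > 0\<close> x by (auto simp: t_def min_def field_simps)
    have "integral {x..x + t} f = 0" using x t by (intro zero) auto
    with d[OF t(1,2)] x show False by (simp add: f_def)
  qed
  have "negligible (N \<union> {0, l})" using N by simp
  then have "AE x in lebesgue. x \<notin> N \<union> {0, l}"
    unfolding negligible_iff_null_sets by (rule AE_not_in)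
  then have "AE x in lebesgue. x \<in> {0..l} \<longrightarrow> h x = 0"
    by eventually_elim (use f0 in auto)
  then show ?thesis by (subst AE_restrict_space_iff) auto
qed

section \<open>Weak derivatives on an interval\<close>

lemma integrable_test_function_scaleR:
  fixes g :: "real \<Rightarrow> complex"
  assumes "test_function l \<phi>" "integrable (lebesgue_on {0..l}) g"
  shows "integrable (lebesgue_on {0..l}) (\<lambda>x. \<phi> x *\<^sub>R g x)"
proof -
  have "compact (\<phi> ` {0..l})"
    using test_functionD(3)[OF assms(1)] by (intro compact_continuous_image) auto
  then obtain B where B: "\<And>x. x \<in> {0..l} \<Longrightarrow> \<bar>\<phi> x\<bar> \<le> B"
    using compact_imp_bounded[of "\<phi> ` {0..l}"] by (fastforce simp: bounded_iff)
  show ?thesis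
  proof (rule Bochner_Integration.integrable_bound)
    show "integrable (lebesgue_on {0..l}) (\<lambda>x. B *\<^sub>R g x)" using assms(2) by simp
    show "(\<lambda>x. \<phi> x *\<^sub>R g x) \<in> borel_measurable (lebesgue_on {0..l})"
      by (intro borel_measurable_scaleR borel_measurable_integrable[OF assms(2)]
          borel_measurable_integrable[OF continuous_imp_integrable_real] test_functionD(3)[OF assms(1)])
    show "AE x in lebesgue_on {0..l}. norm (\<phi> x *\<^sub>R g x) \<le> norm (B *\<^sub>R g x)"
      using B by (intro AE_I2) (force intro!: mult_right_mono)
  qed
qed

lemma weak_derivative_unique:
  assumes "L2_interval l g" "weak_derivative l u g" "L2_interval l g'" "weak_derivative l u g'"
  shows "AE x in lebesgue_on {0..l}. g x = g' x"
proof -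
  have i: "integrable (lebesgue_on {0..l}) g" "integrable (lebesgue_on {0..l}) g'"
    using assms integrable_of_L2_interval by auto
  have "AE x in lebesgue_on {0..l}. g x - g' x = 0"
  proof (rule fundamental_lemma_calculus_of_variations)
    show "integrable (lebesgue_on {0..l}) (\<lambda>x. g x - g' x)" using i by simp
    fix \<phi> assume \<phi>: "test_function l \<phi>"
    show "(LINT x|lebesgue_on {0..l}. \<phi> x *\<^sub>R (g x - g' x)) = 0"
      using assms(2,4) \<phi> integrable_test_function_scaleR[OF \<phi>] i
      by (simp add: weak_derivative_def scaleR_diff_right)
  qed
  then show ?thesis by simp
qed

lemma weak_derivative_affine:
  assumes "0 \<le> l"
  shows "weak_derivative l (\<lambda>x. \<alpha> + x *\<^sub>R \<beta>) (\<lambda>_. \<beta>)"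
  unfolding weak_derivative_def
proof (intro allI impI)
  fix \<phi> assume \<phi>: "test_function l \<phi>"
  let ?M = "lebesgue_on {0..l}"
  have i: "integrable ?M (\<lambda>x. deriv \<phi> x *\<^sub>R (\<alpha> + x *\<^sub>R \<beta>))" "integrable ?M (\<lambda>x. \<phi> x *\<^sub>R \<beta>)"
    by (intro continuous_imp_integrable_real continuous_intros test_functionD[OF \<phi>])+
  have "((\<lambda>x. \<phi> x *\<^sub>R (\<alpha> + x *\<^sub>R \<beta>)) has_vector_derivative deriv \<phi> x *\<^sub>R (\<alpha> + x *\<^sub>R \<beta>) + \<phi> x *\<^sub>R \<beta>)
      (at x within {0..l})" for x
  proof -
    have "((\<lambda>x. \<alpha> + x *\<^sub>R \<beta>) has_vector_derivative \<beta>) (at x within {0..l})"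
      using has_vector_derivative_add[OF has_vector_derivative_const
          has_vector_derivative_scaleR[OF DERIV_ident has_vector_derivative_const]]
      by simp
    from has_vector_derivative_scaleR[OF DERIV_subset[OF test_functionD(1)[OF \<phi>] subset_UNIV] this]
    show ?thesis by (simp add: add.commute)
  qed
  then have "(LINT x|?M. deriv \<phi> x *\<^sub>R (\<alpha> + x *\<^sub>R \<beta>) + \<phi> x *\<^sub>R \<beta>)
      = \<phi> l *\<^sub>R (\<alpha> + l *\<^sub>R \<beta>) - \<phi> 0 *\<^sub>R (\<alpha> + 0 *\<^sub>R \<beta>)"
    by (rule integral_lebesgue_on_FTC[OF assms, rotated])
      (intro continuous_intros test_functionD[OF \<phi>])
  then have "(LINT x|?M. deriv \<phi> x *\<^sub>R (\<alpha> + x *\<^sub>R \<beta>) + \<phi> x *\<^sub>R \<beta>) = 0"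
    using test_functionD(4,5)[OF \<phi>] by simp
  then show "(LINT x|?M. deriv \<phi> x *\<^sub>R (\<alpha> + x *\<^sub>R \<beta>)) = - (LINT x|?M. \<phi> x *\<^sub>R \<beta>)"
    using i by (simp add: add_eq_0_iff2)
qed

text \<open>
  This covers the real and imaginary part of \<open>u\<close>, scalings, and the addition of constants.
\<close>

lemma weak_derivative_add_linear_image:
  assumes T: "bounded_linear T" and l: "0 \<le> l"
    and u: "continuous_on {0..l} u" and g: "L2_interval l g" and w: "weak_derivative l u g"
  shows "weak_derivative l (\<lambda>x. k + T (u x)) (\<lambda>x. T (g x))"
  unfolding weak_derivative_def
proof (intro allI impI)
  fix \<phi> assume \<phi>: "test_function l \<phi>"
  let ?M = "lebesgue_on {0..l}"
  interpret T: bounded_linear T by fact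
  have i: "integrable ?M (\<lambda>x. deriv \<phi> x *\<^sub>R u x)" "integrable ?M (\<lambda>x. deriv \<phi> x *\<^sub>R k)"
      "integrable ?M (\<lambda>x. deriv \<phi> x *\<^sub>R T (u x))"
    by (intro continuous_imp_integrable_real continuous_intros test_functionD[OF \<phi>] u
        T.continuous_on)+
  have j: "integrable ?M (\<lambda>x. \<phi> x *\<^sub>R g x)"
    using integrable_test_function_scaleR[OF \<phi> integrable_of_L2_interval[OF g]] .
  have "(LINT x|?M. deriv \<phi> x *\<^sub>R (k + T (u x)))
      = (LINT x|?M. deriv \<phi> x *\<^sub>R k) + (LINT x|?M. T (deriv \<phi> x *\<^sub>R u x))"
    using i by (simp add: scaleR_add_right T.scaleR)
  also have "(LINT x|?M. deriv \<phi> x *\<^sub>R k) = 0"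
    using weak_derivative_affine[OF l, of k 0] \<phi> by (simp add: weak_derivative_def)
  also have "(LINT x|?M. T (deriv \<phi> x *\<^sub>R u x)) = T (LINT x|?M. deriv \<phi> x *\<^sub>R u x)"
    by (rule integral_bounded_linear[OF T i(1)])
  also have "\<dots> = - T (LINT x|?M. \<phi> x *\<^sub>R g x)"
    using w \<phi> by (simp add: weak_derivative_def T.neg)
  also have "T (LINT x|?M. \<phi> x *\<^sub>R g x) = (LINT x|?M. \<phi> x *\<^sub>R T (g x))"
    by (subst integral_bounded_linear[OF T j, symmetric]) (simp add: T.scaleR)
  finally show "(LINT x|?M. deriv \<phi> x *\<^sub>R (k + T (u x))) = - (LINT x|?M. \<phi> x *\<^sub>R T (g x))"
    by simp
qed

section \<open>Integration on a metric graph\<close>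

text \<open>
  Integrability on every edge, the condition under which \<^const>\<open>graph_integral\<close> is additive.
\<close>

definition edgewise_integrable ::
  "('v, 'e) pre_digraph \<Rightarrow> ('e \<Rightarrow> real) \<Rightarrow> ('e \<Rightarrow> real \<Rightarrow> 'b::{banach, second_countable_topology}) \<Rightarrow> bool"
where
  "edgewise_integrable G L f \<longleftrightarrow> (\<forall>e\<in>arcs G. integrable (lebesgue_on {0..L e}) (f e))"

lemma edgewise_integrable_continuous:
  fixes f :: "'e \<Rightarrow> real \<Rightarrow> 'b::euclidean_space"
  assumes "\<And>e. e \<in> arcs G \<Longrightarrow> continuous_on {0..L e} (f e)"
  shows "edgewise_integrable G L f"
  using assms unfolding edgewise_integrable_def by (blast intro: continuous_imp_integrable_real)

lemma graph_integral_add: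
  assumes "edgewise_integrable G L f" and "edgewise_integrable G L g"
  shows "graph_integral G L (\<lambda>e x. f e x + g e x) = graph_integral G L f + graph_integral G L g"
  using assms by (simp add: graph_integral_def edgewise_integrable_def sum.distrib)

lemma graph_integral_mult:
  fixes c :: real
  shows "graph_integral G L (\<lambda>e x. c * f e x) = c * graph_integral G L f"
  by (simp add: graph_integral_def sum_distrib_left)

lemma graph_integral_const:
  fixes c :: "'b::euclidean_space"
  assumes "\<And>e. e \<in> arcs G \<Longrightarrow> 0 \<le> L e"
  shows "graph_integral G L (\<lambda>e x. c) = total_length G L *\<^sub>R c"
proof -
  have "graph_integral G L (\<lambda>e x. c) = (\<Sum>e\<in>arcs G. L e *\<^sub>R c)"
    unfolding graph_integral_def by (intro sum.cong refl integral_lebesgue_on_const assms)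
  then show ?thesis by (simp add: total_length_def scaleR_left.sum)
qed

lemma graph_integral_mono:
  fixes f g :: "'e \<Rightarrow> real \<Rightarrow> real"
  assumes "edgewise_integrable G L f" and "edgewise_integrable G L g"
    and "\<And>e x. e \<in> arcs G \<Longrightarrow> f e x \<le> g e x"
  shows "graph_integral G L f \<le> graph_integral G L g"
  unfolding graph_integral_def
  using assms by (intro sum_mono integral_mono) (auto simp: edgewise_integrable_def)

lemma graph_integral_nonneg:
  fixes f :: "'e \<Rightarrow> real \<Rightarrow> real"
  assumes "\<And>e x. e \<in> arcs G \<Longrightarrow> 0 \<le> f e x"
  shows "0 \<le> graph_integral G L f"
  unfolding graph_integral_def using assms by (intro sum_nonneg) simp

lemma graph_integral_bounded_linear:
  assumes "bounded_linear T" and "edgewise_integrable G L f"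
  shows "graph_integral G L (\<lambda>e x. T (f e x)) = T (graph_integral G L f)"
  unfolding graph_integral_def linear_sum[OF bounded_linear.linear[OF assms(1)]]
  using assms by (intro sum.cong refl integral_bounded_linear) (auto simp: edgewise_integrable_def)

lemma graph_integral_norm_squared_pos:
  assumes fin: "finite (arcs G)" and L: "\<And>e. e \<in> arcs G \<Longrightarrow> 0 < L e"
    and u: "\<And>e. e \<in> arcs G \<Longrightarrow> continuous_on {0..L e} (u e)"
    and nz: "e0 \<in> arcs G" "x0 \<in> {0..L e0}" "u e0 x0 \<noteq> 0"
  shows "0 < graph_integral G L (\<lambda>e x. (norm (u e x))\<^sup>2)"
  unfolding graph_integral_def
proof (rule sum_pos2[OF fin nz(1)])
  have c: "continuous_on {0..L e0} (\<lambda>x. (norm (u e0 x))\<^sup>2)"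
    by (intro continuous_on_power continuous_on_norm u nz)
  have "integral {0..L e0} (\<lambda>x. (norm (u e0 x))\<^sup>2) \<noteq> 0"
    using integral_eq_0_iff[OF c] L[OF nz(1)] nz by auto
  then have "(LINT x|lebesgue_on {0..L e0}. (norm (u e0 x))\<^sup>2) \<noteq> 0"
    by (subst lebesgue_integral_eq_integral[OF continuous_imp_integrable_real[OF c]]) auto
  moreover have "0 \<le> (LINT x|lebesgue_on {0..L e0}. (norm (u e0 x))\<^sup>2)"
    by simp
  ultimately show "0 < (LINT x|lebesgue_on {0..L e0}. (norm (u e0 x))\<^sup>2)" by linarith
qed simp

lemma Lp_norm_power:
  assumes "0 < p"
  shows "Lp_norm G L p u ^ p = graph_integral G L (\<lambda>e x. norm (u e x) ^ p)"
  unfolding Lp_norm_def by (rule real_root_pow_pos2[OF assms graph_integral_nonneg]) simp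

section \<open>Dirichlet integral and energy\<close>

text \<open>
  The squared \<open>L\<^sup>2\<close> norm of the derivative. By uniqueness of weak derivatives it does not depend on the
  one selected by \<^const>\<open>graph_deriv\<close>.
\<close>

definition dirichlet_integral ::
  "('v, 'e) pre_digraph \<Rightarrow> ('e \<Rightarrow> real) \<Rightarrow> ('e \<Rightarrow> real \<Rightarrow> complex) \<Rightarrow> real" where
  "dirichlet_integral G L u = graph_integral G L (\<lambda>e x. (norm (graph_deriv L u e x))\<^sup>2)"

lemma H1D:
  assumes "u \<in> H1 G L" and "e \<in> arcs G"
  shows "continuous_on {0..L e} (u e)" and "L2_interval (L e) (graph_deriv L u e)"
    and "weak_derivative (L e) (u e) (graph_deriv L u e)"
proof -
  show "continuous_on {0..L e} (u e)"
    using assms by (auto simp: H1_def graph_continuous_def)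
  have "\<exists>g. L2_interval (L e) g \<and> weak_derivative (L e) (u e) g"
    using assms by (auto simp: H1_def H1_interval_def)
  then have "L2_interval (L e) (graph_deriv L u e) \<and> weak_derivative (L e) (u e) (graph_deriv L u e)"
    unfolding graph_deriv_def by (rule someI_ex)
  then show "L2_interval (L e) (graph_deriv L u e)"
    and "weak_derivative (L e) (u e) (graph_deriv L u e)" by auto
qed

lemma integral_norm_graph_deriv:
  assumes g: "L2_interval (L e) g" and w: "weak_derivative (L e) (u e) g"
  shows "(LINT x|lebesgue_on {0..L e}. (norm (graph_deriv L u e x))\<^sup>2)
       = (LINT x|lebesgue_on {0..L e}. (norm (g x))\<^sup>2)"
proof -
  have d: "L2_interval (L e) (graph_deriv L u e) \<and> weak_derivative (L e) (u e) (graph_deriv L u e)"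
    unfolding graph_deriv_def by (rule someI[of _ g]) (use g w in blast)
  have "AE x in lebesgue_on {0..L e}. graph_deriv L u e x = g x"
    using weak_derivative_unique[of "L e" "graph_deriv L u e" "u e" g] d g w by blast
  then have "AE x in lebesgue_on {0..L e}. (norm (graph_deriv L u e x))\<^sup>2 = (norm (g x))\<^sup>2"
    by eventually_elim simp
  then show ?thesis
    using d g by (intro integral_cong_AE) (auto simp: L2_interval_def)
qed

lemma H1_add_linear_image:
  assumes T: "bounded_linear T" and u: "u \<in> H1 G L" and L: "\<And>e. e \<in> arcs G \<Longrightarrow> 0 \<le> L e"
  shows "(\<lambda>e x. k + T (u e x)) \<in> H1 G L"
    and "dirichlet_integral G L (\<lambda>e x. k + T (u e x))
       = graph_integral G L (\<lambda>e x. (norm (T (graph_deriv L u e x)))\<^sup>2)"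
proof -
  obtain f where f: "\<And>e. e \<in> arcs G \<Longrightarrow> u e 0 = f (tail G e) \<and> u e (L e) = f (head G e)"
    using u by (auto simp: H1_def graph_continuous_def)
  have c: "continuous_on {0..L e} (\<lambda>x. k + T (u e x))" if "e \<in> arcs G" for e
    by (intro continuous_on_add continuous_on_const bounded_linear.continuous_on[OF T] H1D(1)[OF u that])
  have w: "weak_derivative (L e) (\<lambda>x. k + T (u e x)) (\<lambda>x. T (graph_deriv L u e x))"
    "L2_interval (L e) (\<lambda>x. T (graph_deriv L u e x))" if "e \<in> arcs G" for e
    using weak_derivative_add_linear_image[OF T L[OF that] H1D(1-3)[OF u that]]
      L2_interval_linear_image[OF T H1D(2)[OF u that]] by auto
  have "graph_continuous G L (\<lambda>e x. k + T (u e x))"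
    unfolding graph_continuous_def using c f by (auto intro!: exI[of _ "\<lambda>v. k + T (f v)"])
  then show "(\<lambda>e x. k + T (u e x)) \<in> H1 G L"
    using w L2_interval_continuous[OF c] by (auto simp: H1_def H1_interval_def)
  show "dirichlet_integral G L (\<lambda>e x. k + T (u e x))
       = graph_integral G L (\<lambda>e x. (norm (T (graph_deriv L u e x)))\<^sup>2)"
    unfolding dirichlet_integral_def graph_integral_def
    by (intro sum.cong refl integral_norm_graph_deriv w)
qed

text \<open>
  Edgewise affine functions: \<open>f\<close> gives the values at the vertices, \<open>\<beta>\<close> the slopes.
\<close>

lemma H1_edgewise_affine:
  assumes L: "\<And>e. e \<in> arcs G \<Longrightarrow> 0 \<le> L e"
    and "\<And>e. e \<in> arcs G \<Longrightarrow> \<alpha> e = f (tail G e)"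
    and "\<And>e. e \<in> arcs G \<Longrightarrow> \<alpha> e + L e *\<^sub>R \<beta> e = f (head G e)"
  shows "(\<lambda>e x. \<alpha> e + x *\<^sub>R \<beta> e) \<in> H1 G L"
    and "dirichlet_integral G L (\<lambda>e x. \<alpha> e + x *\<^sub>R \<beta> e) = (\<Sum>e\<in>arcs G. L e * (norm (\<beta> e))\<^sup>2)"
proof -
  have c: "continuous_on S (\<lambda>x. \<alpha> e + x *\<^sub>R \<beta> e)" for e S by (intro continuous_intros)
  have w: "weak_derivative (L e) (\<lambda>x. \<alpha> e + x *\<^sub>R \<beta> e) (\<lambda>_. \<beta> e)" if "e \<in> arcs G" for e
    using weak_derivative_affine L[OF that] .
  have b: "L2_interval (L e) (\<lambda>_. \<beta> e)" for e by (intro L2_interval_continuous continuous_intros)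
  have "graph_continuous G L (\<lambda>e x. \<alpha> e + x *\<^sub>R \<beta> e)"
    unfolding graph_continuous_def
  proof (intro conjI ballI exI[of _ f])
    show "continuous_on {0..L e} (\<lambda>x. \<alpha> e + x *\<^sub>R \<beta> e)" for e by (rule c)
  qed (use assms(2,3) in auto)
  moreover have "H1_interval (L e) (\<lambda>x. \<alpha> e + x *\<^sub>R \<beta> e)" if "e \<in> arcs G" for e
    unfolding H1_interval_def using w[OF that] b L2_interval_continuous[OF c] by blast
  ultimately show "(\<lambda>e x. \<alpha> e + x *\<^sub>R \<beta> e) \<in> H1 G L" by (simp add: H1_def)
  show "dirichlet_integral G L (\<lambda>e x. \<alpha> e + x *\<^sub>R \<beta> e) = (\<Sum>e\<in>arcs G. L e * (norm (\<beta> e))\<^sup>2)"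
    unfolding dirichlet_integral_def graph_integral_def
  proof (intro sum.cong refl)
    fix e assume e: "e \<in> arcs G"
    show "(LINT x|lebesgue_on {0..L e}. (norm (graph_deriv L (\<lambda>e x. \<alpha> e + x *\<^sub>R \<beta> e) e x))\<^sup>2)
        = L e * (norm (\<beta> e))\<^sup>2"
      by (subst integral_norm_graph_deriv[where e=e and L=L and g="\<lambda>_. \<beta> e"
            and u="\<lambda>e x. \<alpha> e + x *\<^sub>R \<beta> e", OF b w[OF e]], subst integral_lebesgue_on_const) (simp_all add: L e)
  qed
qed

lemma energy_eq:
  "energy G L u = dirichlet_integral G L u / 2 - graph_integral G L (\<lambda>e x. norm (u e x) ^ 6) / 6"
  by (simp add: energy_def dirichlet_integral_def Lp_norm_power)

text \<open>
  Only the values on the edges matter: off them, \<open>u\<close> is arbitrary.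
\<close>

lemma mass_energy_constant:
  assumes L: "\<And>e. e \<in> arcs G \<Longrightarrow> 0 \<le> L e"
    and u: "\<And>e x. e \<in> arcs G \<Longrightarrow> x \<in> {0..L e} \<Longrightarrow> u e x = c"
  shows "(Lp_norm G L 2 u)\<^sup>2 = (norm c)\<^sup>2 * total_length G L"
    and "energy G L u = - ((norm c) ^ 6 * total_length G L / 6)"
proof -
  have *: "graph_integral G L (\<lambda>e x. norm (u e x) ^ p) = norm c ^ p * total_length G L" for p
  proof -
    have "graph_integral G L (\<lambda>e x. norm (u e x) ^ p) = graph_integral G L (\<lambda>e x. norm c ^ p)"
      unfolding graph_integral_def
      by (intro sum.cong refl Bochner_Integration.integral_cong) (auto simp: u)
    then show ?thesis using graph_integral_const[where G=G and L=L and c="norm c ^ p", OF L] by simp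
  qed
  have "graph_integral G L (\<lambda>e x. (norm (graph_deriv L u e x))\<^sup>2) = 0"
    unfolding graph_integral_def
  proof (intro sum.neutral ballI)
    fix e assume e: "e \<in> arcs G"
    have "weak_derivative (L e) (\<lambda>x. c + x *\<^sub>R 0) (\<lambda>_. 0)"
      by (rule weak_derivative_affine[OF L[OF e]])
    moreover have "(LINT x|lebesgue_on {0..L e}. deriv \<psi> x *\<^sub>R u e x)
        = (LINT x|lebesgue_on {0..L e}. deriv \<psi> x *\<^sub>R (c + x *\<^sub>R 0))" for \<psi>
      by (intro Bochner_Integration.integral_cong) (auto simp: u[OF e])
    ultimately have "weak_derivative (L e) (u e) (\<lambda>_. 0)"
      by (simp add: weak_derivative_def)
    moreover have "L2_interval (L e) (\<lambda>_. 0)" by (intro L2_interval_continuous continuous_intros)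
    ultimately show "(LINT x|lebesgue_on {0..L e}. (norm (graph_deriv L u e x))\<^sup>2) = 0"
      by (subst integral_norm_graph_deriv) auto
  qed
  with * show "energy G L u = - ((norm c) ^ 6 * total_length G L / 6)"
    by (simp add: energy_eq dirichlet_integral_def)
  show "(Lp_norm G L 2 u)\<^sup>2 = (norm c)\<^sup>2 * total_length G L"
    by (simp add: Lp_norm_power *)
qed

section \<open>Instability of constants\<close>

text \<open>
  For \<open>w\<close> real of mean zero with \<open>\<integral>w\<^sup>3 \<ge> 0\<close>, \<open>N = \<integral>w\<^sup>2\<close> and \<open>D = \<integral>|w'|\<^sup>2\<close>, the left-hand side of the last
  inequality bounds the energy of the competitor \<open>s * (\<kappa> + \<epsilon> * w)\<close> from above, and the right-hand
  side is the energy of the constant \<open>\<kappa>\<close> of mass \<open>\<mu>\<close>. The second condition says that the competitor has mass \<open>\<mu>\<close>. With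
  \<open>a = \<epsilon>\<^sup>2 * N / \<mu>\<close> and \<open>q = D / N\<close>, the inequality becomes
  \<open>3 * q * (1 + a)\<^sup>2 < \<kappa>^4 * (12 - 3 * a - a\<^sup>2)\<close>, which at \<open>a = 0\<close> reads \<open>q < 4 * \<kappa>^4\<close>.
\<close>

lemma perturbation_parameters:
  fixes \<kappa> \<mu> N D :: real
  assumes "0 < \<kappa>" "0 < \<mu>" "0 < N" and D: "D < 4 * \<kappa> ^ 4 * N"
  obtains \<epsilon> s :: real where "0 < \<epsilon>" and "s\<^sup>2 * (\<mu> + \<epsilon>\<^sup>2 * N) = \<mu>"
    and "s\<^sup>2 * \<epsilon>\<^sup>2 * D / 2 - s ^ 6 * (\<kappa> ^ 4 * \<mu> + 15 * \<kappa> ^ 4 * \<epsilon>\<^sup>2 * N) / 6 < - (\<kappa> ^ 4 * \<mu> / 6)"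
proof -
  define q where "q = D / N"
  have q: "q < 4 * \<kappa> ^ 4" "D = q * N"
    using assms by (simp_all add: q_def divide_simps mult.commute)
  have "((\<lambda>a. \<kappa> ^ 4 * (12 - 3 * a - a\<^sup>2) - 3 * q * (1 + a)\<^sup>2) \<longlongrightarrow>
      \<kappa> ^ 4 * (12 - 3 * 0 - 0\<^sup>2) - 3 * q * (1 + 0)\<^sup>2) (at_right 0)"
    by (intro tendsto_intros)
  then have "\<forall>\<^sub>F a in at_right 0. 0 < \<kappa> ^ 4 * (12 - 3 * a - a\<^sup>2) - 3 * q * (1 + a)\<^sup>2"
    by (rule order_tendstoD(1)) (use q in simp)
  then have "\<forall>\<^sub>F a in at_right (0::real). 0 < a \<and> 0 < \<kappa> ^ 4 * (12 - 3 * a - a\<^sup>2) - 3 * q * (1 + a)\<^sup>2"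
    using eventually_at_right_less by (rule eventually_conj[rotated])
  then obtain a where a: "0 < a" "3 * q * (1 + a)\<^sup>2 < \<kappa> ^ 4 * (12 - 3 * a - a\<^sup>2)"
    using eventually_happens'[OF trivial_limit_at_right_real] by force
  define \<epsilon> s where "\<epsilon> = sqrt (a * \<mu> / N)" and "s = 1 / sqrt (1 + a)"
  have e2: "\<epsilon>\<^sup>2 = a * \<mu> / N" and s2: "s\<^sup>2 = 1 / (1 + a)"
    using a assms by (simp_all add: \<epsilon>_def s_def power_divide)
  have s6: "s ^ 6 = 1 / (1 + a) ^ 3"
    using s2 power_mult[of s 2 3] by (simp add: power_divide)
  have eN: "\<epsilon>\<^sup>2 * N = a * \<mu>" using assms e2 by simp
  show thesis
  proof
    show "0 < \<epsilon>" using a assms by (simp add: \<epsilon>_def)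
    have "\<mu> + \<epsilon>\<^sup>2 * N = (1 + a) * \<mu>" using eN by (simp add: algebra_simps)
    then show "s\<^sup>2 * (\<mu> + \<epsilon>\<^sup>2 * N) = \<mu>" using a by (simp add: s2)
    have "a * \<mu> * (3 * q * (1 + a)\<^sup>2) < a * \<mu> * (\<kappa> ^ 4 * (12 - 3 * a - a\<^sup>2))"
      using a assms by simp
    also have "\<dots> = \<kappa> ^ 4 * \<mu> * (1 + 15 * a) - \<kappa> ^ 4 * \<mu> * (1 + a) ^ 3"
      by (simp add: algebra_simps power2_eq_square power3_eq_cube)
    finally have "(a * \<mu> * (3 * q * (1 + a)\<^sup>2) - \<kappa> ^ 4 * \<mu> * (1 + 15 * a)) / (6 * (1 + a) ^ 3)
        < (- (\<kappa> ^ 4 * \<mu> * (1 + a) ^ 3)) / (6 * (1 + a) ^ 3)"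
      using a by (intro divide_strict_right_mono) auto
    also have "\<dots> = - (\<kappa> ^ 4 * \<mu> / 6)" using a by simp
    also have "(a * \<mu> * (3 * q * (1 + a)\<^sup>2) - \<kappa> ^ 4 * \<mu> * (1 + 15 * a)) / (6 * (1 + a) ^ 3)
        = (1 / (1 + a)) * (a * \<mu>) * q / 2 - 1 / (1 + a) ^ 3 * (\<kappa> ^ 4 * \<mu> + 15 * \<kappa> ^ 4 * (a * \<mu>)) / 6"
      using a by (simp add: divide_simps power2_eq_square power3_eq_cube) (simp add: algebra_simps)
    also have "\<dots> = s\<^sup>2 * \<epsilon>\<^sup>2 * D / 2 - s ^ 6 * (\<kappa> ^ 4 * \<mu> + 15 * \<kappa> ^ 4 * \<epsilon>\<^sup>2 * N) / 6"
      unfolding s2 s6 q(2) eN[symmetric] by (simp add: mult_ac)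
    finally show "s\<^sup>2 * \<epsilon>\<^sup>2 * D / 2 - s ^ 6 * (\<kappa> ^ 4 * \<mu> + 15 * \<kappa> ^ 4 * \<epsilon>\<^sup>2 * N) / 6 < - (\<kappa> ^ 4 * \<mu> / 6)" .
  qed
qed

lemma sixth_power_lower_bound:
  fixes \<kappa> z :: real
  shows "\<kappa> ^ 6 + 6 * \<kappa> ^ 5 * z + 15 * \<kappa> ^ 4 * z\<^sup>2 + 20 * \<kappa> ^ 3 * z ^ 3 \<le> (\<kappa> + z) ^ 6"
proof -
  have "(\<kappa> + z) ^ 6 = \<kappa> ^ 6 + 6 * \<kappa> ^ 5 * z + 15 * \<kappa> ^ 4 * z\<^sup>2 + 20 * \<kappa> ^ 3 * z ^ 3
      + (z\<^sup>2)\<^sup>2 * ((z + 3 * \<kappa>)\<^sup>2 + 6 * \<kappa>\<^sup>2)"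
    by (simp add: eval_nat_numeral algebra_simps)
  moreover have "0 \<le> (z\<^sup>2)\<^sup>2 * ((z + 3 * \<kappa>)\<^sup>2 + 6 * \<kappa>\<^sup>2)" by simp
  ultimately show ?thesis by linarith
qed

text \<open>
  A strict upper bound on the Rayleigh quotient of \<open>\<phi>\<close> passes to \<open>\<rho> \<circ> \<phi>\<close>, where \<open>\<rho>\<close> is the real or
  the imaginary part up to sign; the sign is chosen to make the integral of the cube nonnegative.
\<close>

lemma real_part_reduction:
  assumes \<phi>: "\<phi> \<in> H1 G L"
    and mean: "graph_integral G L \<phi> = 0"
    and quot: "dirichlet_integral G L \<phi> < c * graph_integral G L (\<lambda>e x. (norm (\<phi> e x))\<^sup>2)"
  obtains \<rho> :: "complex \<Rightarrow> real" where "bounded_linear \<rho>"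
    and "graph_integral G L (\<lambda>e x. \<rho> (\<phi> e x)) = 0"
    and "0 \<le> graph_integral G L (\<lambda>e x. (\<rho> (\<phi> e x)) ^ 3)"
    and "graph_integral G L (\<lambda>e x. (\<rho> (graph_deriv L \<phi> e x))\<^sup>2)
      < c * graph_integral G L (\<lambda>e x. (\<rho> (\<phi> e x))\<^sup>2)"
proof -
  define D where "D = (\<lambda>\<rho>. graph_integral G L (\<lambda>e x. (\<rho> (graph_deriv L \<phi> e x))\<^sup>2) :: real)"
  define N where "N = (\<lambda>\<rho>. graph_integral G L (\<lambda>e x. (\<rho> (\<phi> e x))\<^sup>2) :: real)"
  have split: "graph_integral G L (\<lambda>e x. (norm (f e x))\<^sup>2)
      = graph_integral G L (\<lambda>e x. (Re (f e x))\<^sup>2) + graph_integral G L (\<lambda>e x. (Im (f e x))\<^sup>2)"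
    if f: "\<And>e. e \<in> arcs G \<Longrightarrow> L2_interval (L e) (f e)" for f :: "'a \<Rightarrow> real \<Rightarrow> complex"
  proof -
    have "L2_interval (L e) (\<lambda>x. complex_of_real (Re (f e x)))"
      "L2_interval (L e) (\<lambda>x. complex_of_real (Im (f e x)))" if "e \<in> arcs G" for e
      by (intro L2_interval_linear_image[OF _ f[OF that]] bounded_linear_compose[OF bounded_linear_of_real]
          bounded_linear_Re bounded_linear_Im)+
    then have "edgewise_integrable G L (\<lambda>e x. (Re (f e x))\<^sup>2)"
      "edgewise_integrable G L (\<lambda>e x. (Im (f e x))\<^sup>2)"
      by (auto simp: edgewise_integrable_def L2_interval_def)
    then show ?thesis by (simp add: cmod_power2 graph_integral_add)
  qed
  have "D Re + D Im < c * (N Re + N Im)"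
    using quot split[of \<phi>] split[of "graph_deriv L \<phi>"] H1D(2)[OF \<phi>] L2_interval_continuous[OF H1D(1)[OF \<phi>]]
    by (simp add: D_def N_def dirichlet_integral_def)
  then have "D Re < c * N Re \<or> D Im < c * N Im" by (auto simp: algebra_simps)
  then obtain \<rho>0 :: "complex \<Rightarrow> real" where \<rho>0: "bounded_linear \<rho>0" "D \<rho>0 < c * N \<rho>0"
    using bounded_linear_Re bounded_linear_Im by blast
  have int: "edgewise_integrable G L \<phi>"
    by (intro edgewise_integrable_continuous H1D(1)[OF \<phi>])
  have bl: "bounded_linear (\<lambda>z. - \<rho>0 z)" using \<rho>0(1) by (rule bounded_linear_minus)
  have mean0: "graph_integral G L (\<lambda>e x. \<rho> (\<phi> e x)) = 0" if "bounded_linear \<rho>" for \<rho> :: "complex \<Rightarrow> real"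
    using graph_integral_bounded_linear[OF that int] mean linear_0[OF bounded_linear.linear[OF that]] by simp
  show thesis
  proof (cases "0 \<le> graph_integral G L (\<lambda>e x. (\<rho>0 (\<phi> e x)) ^ 3)")
    case True
    then show thesis using that[of \<rho>0] \<rho>0 mean0 by (simp add: D_def N_def)
  next
    case False
    moreover have "graph_integral G L (\<lambda>e x. (- \<rho>0 (\<phi> e x)) ^ 3)
        = - graph_integral G L (\<lambda>e x. (\<rho>0 (\<phi> e x)) ^ 3)"
      using graph_integral_mult[of G L "-1" "\<lambda>e x. (\<rho>0 (\<phi> e x)) ^ 3"] by simp
    ultimately show thesis using that[of "\<lambda>z. - \<rho>0 z"] \<rho>0 mean0[OF bl] bl by (simp add: D_def N_def)
  qed
qed

text \<open>
  The constant \<open>\<kappa>\<close> has mass \<open>\<mu>\<close> and energy \<open>- \<kappa>^4 * \<mu> / 6\<close>. The factor \<open>4 * \<kappa>^4\<close> arises from the second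
  variation: the sixth power contributes \<open>15 / 6 * \<kappa>^4 * \<integral>w\<^sup>2\<close>, of which the normalisation of the mass takes
  back \<open>3 / 6 * \<kappa>^4 * \<integral>w\<^sup>2\<close>, and the difference is compared with \<open>1 / 2 * \<integral>|w'|\<^sup>2\<close>.
\<close>

lemma energy_below_constant:
  assumes L0: "\<And>e. e \<in> arcs G \<Longrightarrow> 0 \<le> L e"
    and \<phi>: "\<phi> \<in> H1 G L" and mean: "graph_integral G L \<phi> = 0"
    and \<kappa>: "0 < \<kappa>" and \<mu>: "0 < \<mu>" "\<mu> = \<kappa>\<^sup>2 * total_length G L"
    and quot: "dirichlet_integral G L \<phi> < 4 * \<kappa> ^ 4 * graph_integral G L (\<lambda>e x. (norm (\<phi> e x))\<^sup>2)"
  obtains v where "v \<in> H1_mass G L \<mu>" and "energy G L v < - (\<kappa> ^ 4 * \<mu> / 6)"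
proof -
  obtain \<rho> :: "complex \<Rightarrow> real" where \<rho>: "bounded_linear \<rho>"
    and mean\<rho>: "graph_integral G L (\<lambda>e x. \<rho> (\<phi> e x)) = 0"
    and cube: "0 \<le> graph_integral G L (\<lambda>e x. (\<rho> (\<phi> e x)) ^ 3)"
    and quot\<rho>: "graph_integral G L (\<lambda>e x. (\<rho> (graph_deriv L \<phi> e x))\<^sup>2)
      < 4 * \<kappa> ^ 4 * graph_integral G L (\<lambda>e x. (\<rho> (\<phi> e x))\<^sup>2)"
    using real_part_reduction[OF \<phi> mean quot] by metis
  define D where "D = graph_integral G L (\<lambda>e x. (\<rho> (graph_deriv L \<phi> e x))\<^sup>2)"
  define w where "w = (\<lambda>e x. \<rho> (\<phi> e x))"
  define N where "N = graph_integral G L (\<lambda>e x. (w e x)\<^sup>2)"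
  define C where "C = graph_integral G L (\<lambda>e x. (w e x) ^ 3)"
  have "0 \<le> D" unfolding D_def by (rule graph_integral_nonneg) simp
  with quot\<rho> have "0 < 4 * \<kappa> ^ 4 * N" by (simp add: D_def N_def w_def)
  then have "0 < N" using \<kappa> by (simp add: zero_less_mult_iff)
  obtain \<epsilon> s where \<epsilon>: "0 < \<epsilon>" and mass: "s\<^sup>2 * (\<mu> + \<epsilon>\<^sup>2 * N) = \<mu>"
    and less: "s\<^sup>2 * \<epsilon>\<^sup>2 * D / 2 - s ^ 6 * (\<kappa> ^ 4 * \<mu> + 15 * \<kappa> ^ 4 * \<epsilon>\<^sup>2 * N) / 6 < - (\<kappa> ^ 4 * \<mu> / 6)"
    using perturbation_parameters[OF \<kappa> \<mu>(1) \<open>0 < N\<close>, of D] quot\<rho> by (auto simp: D_def N_def w_def)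
  have cw: "continuous_on {0..L e} (w e)" if "e \<in> arcs G" for e
    unfolding w_def by (rule bounded_linear.continuous_on[OF \<rho> H1D(1)[OF \<phi> that]])
  note int = edgewise_integrable_continuous[of G L]
  define T where "T = (\<lambda>z. complex_of_real (s * \<epsilon> * \<rho> z))"
  define v where "v = (\<lambda>e x. complex_of_real (s * \<kappa>) + T (\<phi> e x))"
  have T: "bounded_linear T"
    unfolding T_def
    by (intro bounded_linear_compose[OF bounded_linear_of_real] bounded_linear_compose[OF bounded_linear_mult_right] \<rho>)
  have v: "v \<in> H1 G L"
    and "dirichlet_integral G L v = graph_integral G L (\<lambda>e x. (norm (T (graph_deriv L \<phi> e x)))\<^sup>2)"
    unfolding v_def by (intro H1_add_linear_image[OF T \<phi> L0], assumption)+
  then have Dv: "dirichlet_integral G L v = s\<^sup>2 * \<epsilon>\<^sup>2 * D"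
    unfolding T_def D_def graph_integral_mult[symmetric] by (simp add: norm_mult abs_mult power_mult_distrib)
  have v_eq: "v e x = complex_of_real (s * (\<kappa> + \<epsilon> * w e x))" for e x
    by (simp add: v_def T_def w_def algebra_simps)
  have "graph_integral G L (\<lambda>e x. (norm (v e x))\<^sup>2)
      = graph_integral G L (\<lambda>e x. s\<^sup>2 * (\<kappa>\<^sup>2 + (2 * \<kappa> * \<epsilon> * w e x + \<epsilon>\<^sup>2 * (w e x)\<^sup>2)))"
    unfolding v_eq norm_of_real power2_abs
    by (simp add: power2_eq_square algebra_simps)
  also have "\<dots> = s\<^sup>2 * (total_length G L * \<kappa>\<^sup>2 + (2 * \<kappa> * \<epsilon> * graph_integral G L w + \<epsilon>\<^sup>2 * N))"
    unfolding N_def graph_integral_mult[of G L "s\<^sup>2"]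
    by (subst graph_integral_add | intro int continuous_intros cw | assumption
        | simp add: graph_integral_mult graph_integral_const[OF L0])+
  also have "\<dots> = \<mu>" using mean\<rho> mass \<mu>(2) by (simp add: w_def mult.commute)
  finally have mass_v: "graph_integral G L (\<lambda>e x. (norm (v e x))\<^sup>2) = \<mu>" .
  have "s ^ 6 * (\<kappa> ^ 4 * \<mu> + 15 * \<kappa> ^ 4 * \<epsilon>\<^sup>2 * N)
      \<le> s ^ 6 * (\<kappa> ^ 6 * total_length G L + (6 * \<kappa> ^ 5 * \<epsilon> * graph_integral G L w
          + (15 * \<kappa> ^ 4 * \<epsilon>\<^sup>2 * N + 20 * \<kappa> ^ 3 * \<epsilon> ^ 3 * C)))"
  proof (rule mult_left_mono)
    \<comment> \<open>The only use of the sign of the cubic term.\<close>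
    have "0 \<le> 20 * \<kappa> ^ 3 * \<epsilon> ^ 3 * C" using \<kappa> \<epsilon> cube by (simp add: C_def w_def)
    moreover have "\<kappa> ^ 4 * \<mu> = \<kappa> ^ 6 * total_length G L" by (simp add: \<mu>(2) flip: power_add)
    ultimately show "\<kappa> ^ 4 * \<mu> + 15 * \<kappa> ^ 4 * \<epsilon>\<^sup>2 * N
      \<le> \<kappa> ^ 6 * total_length G L + (6 * \<kappa> ^ 5 * \<epsilon> * graph_integral G L w
          + (15 * \<kappa> ^ 4 * \<epsilon>\<^sup>2 * N + 20 * \<kappa> ^ 3 * \<epsilon> ^ 3 * C))"
      using mean\<rho> by (simp add: w_def)
  qed simp
  also have "\<dots> = graph_integral G L (\<lambda>e x. s ^ 6 * (\<kappa> ^ 6 + (6 * \<kappa> ^ 5 * \<epsilon> * w e x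
          + (15 * \<kappa> ^ 4 * \<epsilon>\<^sup>2 * (w e x)\<^sup>2 + 20 * \<kappa> ^ 3 * \<epsilon> ^ 3 * (w e x) ^ 3))))"
    unfolding N_def C_def graph_integral_mult[of G L "s ^ 6"]
    by (subst graph_integral_add | intro int continuous_intros cw | assumption
        | simp add: graph_integral_mult graph_integral_const[OF L0])+
  also have "\<dots> \<le> graph_integral G L (\<lambda>e x. norm (v e x) ^ 6)"
  proof (rule graph_integral_mono)
    have cv: "continuous_on {0..L e} (v e)" if "e \<in> arcs G" for e using H1D(1)[OF v that] .
    show "edgewise_integrable G L (\<lambda>e x. norm (v e x) ^ 6)"
      by (intro int continuous_on_power continuous_on_norm cv)
    show "edgewise_integrable G L (\<lambda>e x. s ^ 6 * (\<kappa> ^ 6 + (6 * \<kappa> ^ 5 * \<epsilon> * w e x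
          + (15 * \<kappa> ^ 4 * \<epsilon>\<^sup>2 * (w e x)\<^sup>2 + 20 * \<kappa> ^ 3 * \<epsilon> ^ 3 * (w e x) ^ 3))))"
      by (intro int continuous_intros cw)
    fix e x
    have "s ^ 6 * (\<kappa> ^ 6 + (6 * \<kappa> ^ 5 * \<epsilon> * w e x
          + (15 * \<kappa> ^ 4 * \<epsilon>\<^sup>2 * (w e x)\<^sup>2 + 20 * \<kappa> ^ 3 * \<epsilon> ^ 3 * (w e x) ^ 3)))
        \<le> s ^ 6 * (\<kappa> + \<epsilon> * w e x) ^ 6"
      using sixth_power_lower_bound[of \<kappa> "\<epsilon> * w e x"]
      by (intro mult_left_mono) (simp_all add: power_mult_distrib mult.assoc)
    also have "\<dots> = norm (v e x) ^ 6"
      unfolding v_eq norm_of_real by (simp add: power_mult_distrib power_even_abs)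
    finally show "s ^ 6 * (\<kappa> ^ 6 + (6 * \<kappa> ^ 5 * \<epsilon> * w e x
          + (15 * \<kappa> ^ 4 * \<epsilon>\<^sup>2 * (w e x)\<^sup>2 + 20 * \<kappa> ^ 3 * \<epsilon> ^ 3 * (w e x) ^ 3)))
        \<le> norm (v e x) ^ 6" .
  qed
  finally have "energy G L v \<le> s\<^sup>2 * \<epsilon>\<^sup>2 * D / 2 - s ^ 6 * (\<kappa> ^ 4 * \<mu> + 15 * \<kappa> ^ 4 * \<epsilon>\<^sup>2 * N) / 6"
    by (simp add: energy_eq Dv)
  also note less
  finally show thesis
    using that[of v] v mass_v by (simp add: H1_mass_def Lp_norm_power)
qed

lemma constant_not_ground_state:
  assumes L0: "\<And>e. e \<in> arcs G \<Longrightarrow> 0 \<le> L e"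
    and \<phi>: "\<phi> \<in> H1 G L" and mean: "graph_integral G L \<phi> = 0" and \<mu>: "0 < \<mu>"
    and quot: "dirichlet_integral G L \<phi>
      < 4 * (\<mu> / total_length G L)\<^sup>2 * graph_integral G L (\<lambda>e x. (norm (\<phi> e x))\<^sup>2)"
    and u: "constant_on_graph G L u"
  shows "\<not> ground_state G L \<mu> u"
proof
  assume gs: "ground_state G L \<mu> u"
  obtain c where c: "\<And>e x. e \<in> arcs G \<Longrightarrow> x \<in> {0..L e} \<Longrightarrow> u e x = c"
    using u by (auto simp: constant_on_graph_def)
  have \<mu>_eq: "\<mu> = (norm c)\<^sup>2 * total_length G L"
    using gs mass_energy_constant(1)[of G L u c, OF L0 c] by (simp add: ground_state_def H1_mass_def)
  with \<mu> have pos: "0 < norm c" "total_length G L \<noteq> 0" by auto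
  have "4 * (\<mu> / total_length G L)\<^sup>2 = 4 * norm c ^ 4"
    using pos by (simp add: \<mu>_eq flip: power_mult)
  with quot energy_below_constant[where G=G and L=L, OF L0 \<phi> mean pos(1) \<mu> \<mu>_eq]
  obtain v where "v \<in> H1_mass G L \<mu>" "energy G L v < - (norm c ^ 4 * \<mu> / 6)" by metis
  moreover have "energy G L u = - (norm c ^ 4 * \<mu> / 6)"
    using mass_energy_constant(2)[of G L u c, OF L0 c] by (simp add: \<mu>_eq flip: power_add)
  ultimately show False using gs by (fastforce simp: ground_state_def)
qed

section \<open>Rayleigh quotients\<close>

text \<open>
  The quotients over which \<^const>\<open>lambda2\<close> is the infimum.
\<close>

definition rayleigh_quotients :: "('v, 'e) pre_digraph \<Rightarrow> ('e \<Rightarrow> real) \<Rightarrow> real set" where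
  "rayleigh_quotients G L =
     {dirichlet_integral G L \<phi> / graph_integral G L (\<lambda>e x. (norm (\<phi> e x))\<^sup>2) | \<phi>.
       \<phi> \<in> H1 G L \<and> (\<exists>e\<in>arcs G. \<exists>x\<in>{0..L e}. \<phi> e x \<noteq> 0) \<and> graph_integral G L \<phi> = 0}"

lemma lambda2_eq_Inf: "lambda2 G L = Inf (rayleigh_quotients G L)"
  by (simp add: lambda2_def rayleigh_quotients_def dirichlet_integral_def)

lemma rayleigh_quotient_nonneg:
  assumes "q \<in> rayleigh_quotients G L"
  shows "0 \<le> q"
  using assms by (auto simp: rayleigh_quotients_def dirichlet_integral_def
      intro!: divide_nonneg_nonneg graph_integral_nonneg)

lemma lambda2_nonneg:
  assumes "rayleigh_quotients G L \<noteq> {}"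
  shows "0 \<le> lambda2 G L"
  unfolding lambda2_eq_Inf using assms by (rule cInf_greatest) (rule rayleigh_quotient_nonneg)

lemma constant_not_ground_state_above_mu1:
  assumes fin: "finite (arcs G)" and L: "\<And>e. e \<in> arcs G \<Longrightarrow> 0 < L e"
    and ne: "rayleigh_quotients G L \<noteq> {}" and \<mu>: "mu1 G L < \<mu>"
    and u: "constant_on_graph G L u"
  shows "\<not> ground_state G L \<mu> u"
proof -
  have "0 \<le> total_length G L" unfolding total_length_def by (intro sum_nonneg less_imp_le L)
  moreover have "total_length G L \<noteq> 0"
  proof -
    obtain e where "e \<in> arcs G" using ne by (auto simp: rayleigh_quotients_def)
    then have "0 < total_length G L" unfolding total_length_def
      using fin L by (intro sum_pos) auto
    then show ?thesis by simp
  qed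
  ultimately have pos: "0 < total_length G L" by simp
  have "0 \<le> mu1 G L" using pos lambda2_nonneg[OF ne] by (simp add: mu1_def)
  with \<mu> have "0 < \<mu>" by simp
  \<comment> \<open>The definition of \<open>mu1\<close>, solved for \<open>lambda2\<close>.\<close>
  have "sqrt (lambda2 G L / 4) < \<mu> / total_length G L"
    using \<mu> pos by (simp add: mu1_def pos_less_divide_eq mult.commute)
  also have "\<mu> / total_length G L = sqrt ((\<mu> / total_length G L)\<^sup>2)"
    using \<open>0 < \<mu>\<close> pos by simp
  finally have "lambda2 G L / 4 < (\<mu> / total_length G L)\<^sup>2"
    by (simp only: real_sqrt_less_iff)
  then have "Inf (rayleigh_quotients G L) < 4 * (\<mu> / total_length G L)\<^sup>2"
    by (simp add: lambda2_eq_Inf)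
  then obtain q where q: "q \<in> rayleigh_quotients G L" "q < 4 * (\<mu> / total_length G L)\<^sup>2"
    using cInf_lessD[OF ne] by blast
  then obtain \<phi> e0 x0 where \<phi>: "\<phi> \<in> H1 G L" "graph_integral G L \<phi> = 0"
    and nz: "e0 \<in> arcs G" "x0 \<in> {0..L e0}" "\<phi> e0 x0 \<noteq> 0"
    and "dirichlet_integral G L \<phi> / graph_integral G L (\<lambda>e x. (norm (\<phi> e x))\<^sup>2)
      < 4 * (\<mu> / total_length G L)\<^sup>2"
    unfolding rayleigh_quotients_def by blast
  moreover have "0 < graph_integral G L (\<lambda>e x. (norm (\<phi> e x))\<^sup>2)"
    by (rule graph_integral_norm_squared_pos[where u=\<phi> and L=L, OF fin L H1D(1)[OF \<phi>(1)] nz])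
  ultimately have "dirichlet_integral G L \<phi>
      < 4 * (\<mu> / total_length G L)\<^sup>2 * graph_integral G L (\<lambda>e x. (norm (\<phi> e x))\<^sup>2)"
    by (simp add: pos_divide_less_eq)
  then show ?thesis
    by (intro constant_not_ground_state[where G=G and L=L and \<phi>=\<phi>] \<phi> \<open>0 < \<mu>\<close> u less_imp_le[OF L])
qed

section \<open>Graphs with a long bridge\<close>

text \<open>
  The set \<open>A\<close> is a connected component of the graph without \<open>b\<close>. If both ends of \<open>b\<close> were on the same
  side, \<open>A\<close> would be closed under adjacency in the whole graph, against connectedness.
\<close>

lemma bridge_separation:
  assumes fin: "fin_digraph G" and con: "Digraph_Component.connected G" and b: "bridging_edge G b"
  obtains A where "\<And>e. e \<in> arcs G \<Longrightarrow> e \<noteq> b \<Longrightarrow> tail G e \<in> A \<longleftrightarrow> head G e \<in> A"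
    and "tail G b \<in> A \<longleftrightarrow> head G b \<notin> A"
proof -
  let ?H = "pre_digraph.del_arc G b"
  interpret G: fin_digraph G by (rule fin)
  interpret H: wf_digraph ?H by (rule G.wf_digraph_del_arc)
  interpret S: pair_wf_digraph "mk_symmetric ?H" by (rule H.wellformed_mk_symmetric)
  have "verts G \<noteq> {}" using con by (auto simp: connected_def strongly_connected_def)
  then obtain u v where uv: "u \<in> verts G" "v \<in> verts G" "\<not> u \<rightarrow>\<^sup>*\<^bsub>mk_symmetric ?H\<^esub> v"
    using b by (auto simp: bridging_edge_def connected_def strongly_connected_def)
  define A where "A = {w. u \<rightarrow>\<^sup>*\<^bsub>mk_symmetric ?H\<^esub> w}"
  have A: "tail G e \<in> A \<longleftrightarrow> head G e \<in> A" if "e \<in> arcs G" "e \<noteq> b" for e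
  proof -
    have "(tail G e, head G e) \<in> parcs (mk_symmetric ?H)" "(head G e, tail G e) \<in> parcs (mk_symmetric ?H)"
      using that by (auto simp: parcs_mk_symmetric G.del_arc_simps)
    then show ?thesis unfolding A_def by (auto intro: S.reachable_adj_trans)
  qed
  have "tail G b \<in> A \<longleftrightarrow> head G b \<notin> A"
  proof (rule ccontr)
    assume "\<not> ?thesis"
    with A have closed: "tail G e \<in> A \<longleftrightarrow> head G e \<in> A" if "e \<in> arcs G" for e
      using that by (cases "e = b") auto
    have "u \<rightarrow>\<^sup>*\<^bsub>mk_symmetric G\<^esub> v"
      using con uv by (auto simp: connected_def strongly_connected_def)
    then have "v \<in> A"
      unfolding reachable_def
    proof (induction rule: rtrancl_on_induct)
      case base
      then show ?case using uv by (simp add: A_def)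
    next
      case (step y z)
      then show ?case using closed by (auto simp: parcs_mk_symmetric)
    qed
    with uv show False by (simp add: A_def)
  qed
  with A show thesis by (rule that)
qed

text \<open>
  In the trial function \<open>\<phi>\<close>, \<open>\<sigma>\<close> is the sign of the side of the bridge on which a vertex lies, \<open>t\<close> the
  sign at the tail of \<open>b\<close>, and \<open>c\<close> the mean of the unshifted function; \<open>R\<close> is the total length of the
  edges other than \<open>b\<close>. On \<open>b\<close> the square of \<open>\<phi>\<close> integrates to \<open>l * c\<^sup>2 + l / 3\<close>, so \<open>c\<close> need not be
  estimated.
\<close>

lemma bridge_rayleigh_quotient:
  assumes fin: "fin_digraph G" and con: "Digraph_Component.connected G" and b: "bridging_edge G b"
    and L: "\<And>e. e \<in> arcs G \<Longrightarrow> 0 < L e"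
  obtains q where "q \<in> rayleigh_quotients G L" and "q \<le> 12 / (L b)\<^sup>2"
proof -
  obtain A where A: "\<And>e. e \<in> arcs G \<Longrightarrow> e \<noteq> b \<Longrightarrow> tail G e \<in> A \<longleftrightarrow> head G e \<in> A"
    and Ab: "tail G b \<in> A \<longleftrightarrow> head G b \<notin> A"
    using bridge_separation[OF fin con b] by metis
  have finA: "finite (arcs G)" using fin by (simp add: fin_digraph.finite_arcs)
  have bG: "b \<in> arcs G" using b by (simp add: bridging_edge_def)
  define l where "l = L b"
  have l: "0 < l" using L[OF bG] by (simp add: l_def)
  define R where "R = (\<Sum>e\<in>arcs G - {b}. L e)"
  have R: "0 \<le> R" unfolding R_def using L by (intro sum_nonneg) (auto intro: less_imp_le)
  define \<sigma> :: "'a \<Rightarrow> real" where "\<sigma> = (\<lambda>v. if v \<in> A then 1 else -1)"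
  define t where "t = \<sigma> (tail G b)"
  have t: "t\<^sup>2 = 1" "\<sigma> (head G b) = - t" using Ab by (auto simp: t_def \<sigma>_def)
  define S where "S = (\<Sum>e\<in>arcs G - {b}. L e * \<sigma> (tail G e))"
  define c where "c = S / (R + l)"
  define \<alpha> where "\<alpha> = (\<lambda>e. complex_of_real (\<sigma> (tail G e) - c))"
  define \<beta> where "\<beta> = (\<lambda>e. complex_of_real (if e = b then - (2 * t / l) else 0))"
  define \<phi> where "\<phi> = (\<lambda>e x. \<alpha> e + x *\<^sub>R \<beta> e)"
  have L0: "\<And>e. e \<in> arcs G \<Longrightarrow> 0 \<le> L e" using L less_imp_le by blast
  have head: "\<alpha> e + L e *\<^sub>R \<beta> e = complex_of_real (\<sigma> (head G e) - c)" if "e \<in> arcs G" for e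
  proof (cases "e = b")
    case True
    have "\<alpha> b + L b *\<^sub>R \<beta> b = complex_of_real (t - c - l * (2 * t / l))"
      by (simp add: \<alpha>_def \<beta>_def t_def l_def scaleR_conv_of_real)
    also have "\<dots> = complex_of_real (\<sigma> (head G b) - c)" using l t by simp
    finally show ?thesis using True by simp
  next
    case False
    then show ?thesis using A[OF that False] by (simp add: \<alpha>_def \<beta>_def \<sigma>_def)
  qed
  have \<phi>H1: "\<phi> \<in> H1 G L"
    and "dirichlet_integral G L \<phi> = (\<Sum>e\<in>arcs G. L e * (norm (\<beta> e))\<^sup>2)"
    unfolding \<phi>_def
    by (intro H1_edgewise_affine[where f="\<lambda>v. complex_of_real (\<sigma> v - c)"] L0 head; simp add: \<alpha>_def)+
  moreover have "(\<Sum>e\<in>arcs G. L e * (norm (\<beta> e))\<^sup>2) = l * (2 * t / l)\<^sup>2"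
  proof -
    have "(norm (\<beta> e))\<^sup>2 = (if e = b then (2 * t / l)\<^sup>2 else 0)" for e
      unfolding \<beta>_def norm_of_real power2_abs by simp
    then show ?thesis unfolding sum.remove[OF finA bG] by (simp add: l_def)
  qed
  ultimately have D: "dirichlet_integral G L \<phi> = 4 / l"
    using t l by (simp add: power_divide power_mult_distrib power2_eq_square divide_simps)
  have "graph_integral G L \<phi> = (\<Sum>e\<in>arcs G. L e *\<^sub>R \<alpha> e + ((L e)\<^sup>2 / 2) *\<^sub>R \<beta> e)"
    unfolding graph_integral_def \<phi>_def by (intro sum.cong refl integral_lebesgue_on_affine L0)
  also have "\<dots> = l *\<^sub>R \<alpha> b + (l\<^sup>2 / 2) *\<^sub>R \<beta> b + (\<Sum>e\<in>arcs G - {b}. L e *\<^sub>R \<alpha> e)"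
    unfolding sum.remove[OF finA bG] by (simp add: \<beta>_def l_def)
  also have "(\<Sum>e\<in>arcs G - {b}. L e *\<^sub>R \<alpha> e) = complex_of_real (S - R * c)"
    by (simp add: \<alpha>_def S_def R_def scaleR_conv_of_real right_diff_distrib sum_subtractf sum_distrib_right)
  also have "l *\<^sub>R \<alpha> b + (l\<^sup>2 / 2) *\<^sub>R \<beta> b = complex_of_real (l * (t - c) - l\<^sup>2 / 2 * (2 * t / l))"
    by (simp add: \<alpha>_def \<beta>_def t_def scaleR_conv_of_real)
  also have "l * (t - c) - l\<^sup>2 / 2 * (2 * t / l) = - (l * c)"
    using l by (simp add: power2_eq_square algebra_simps)
  also have "complex_of_real (- (l * c)) + complex_of_real (S - R * c) = complex_of_real (S - (R + l) * c)"
    by (simp add: algebra_simps)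
  also have "\<dots> = 0" using R l by (simp add: c_def)
  finally have mean: "graph_integral G L \<phi> = 0" .
  have "l / 3 \<le> (LINT x|lebesgue_on {0..L b}. (norm (\<phi> b x))\<^sup>2)"
  proof -
    have "\<phi> b x = complex_of_real ((t - c) + (- (2 * t / l)) * x)" for x
      by (simp add: \<phi>_def \<alpha>_def \<beta>_def t_def scaleR_conv_of_real)
    then have "(LINT x|lebesgue_on {0..L b}. (norm (\<phi> b x))\<^sup>2)
        = (LINT x|lebesgue_on {0..l}. ((t - c) + (- (2 * t / l)) * x)\<^sup>2)"
      by (simp only: norm_of_real power2_abs l_def)
    also have "\<dots> = (t - c)\<^sup>2 * l + (t - c) * (- (2 * t / l)) * l\<^sup>2 + (- (2 * t / l))\<^sup>2 * l ^ 3 / 3"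
      using l by (intro integral_lebesgue_on_affine_squared) simp
    also have "\<dots> = l * ((t - c)\<^sup>2 - 2 * (t - c) * t + 4 * t\<^sup>2 / 3)"
      using l by (simp add: power2_eq_square power3_eq_cube field_simps)
    also have "(t - c)\<^sup>2 - 2 * (t - c) * t + 4 * t\<^sup>2 / 3 = c\<^sup>2 + t\<^sup>2 / 3"
      by (simp add: power2_eq_square algebra_simps)
    also have "l * (c\<^sup>2 + t\<^sup>2 / 3) = l * c\<^sup>2 + l / 3" by (simp add: t algebra_simps)
    finally show ?thesis using l by simp
  qed
  also have "\<dots> \<le> graph_integral G L (\<lambda>e x. (norm (\<phi> e x))\<^sup>2)"
    unfolding graph_integral_def by (rule member_le_sum[OF bG _ finA]) simp
  finally have N: "l / 3 \<le> graph_integral G L (\<lambda>e x. (norm (\<phi> e x))\<^sup>2)" .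
  have nz: "\<exists>e\<in>arcs G. \<exists>x\<in>{0..L e}. \<phi> e x \<noteq> 0"
  proof -
    have "\<phi> b 0 - \<phi> b l = complex_of_real (2 * t)"
      using l by (simp add: \<phi>_def \<beta>_def scaleR_conv_of_real)
    moreover have "t \<noteq> 0" using t by auto
    ultimately have "\<phi> b 0 \<noteq> 0 \<or> \<phi> b l \<noteq> 0" by auto
    then show ?thesis using bG l by (auto simp: l_def intro!: bexI[of _ b])
  qed
  show thesis
  proof
    show "dirichlet_integral G L \<phi> / graph_integral G L (\<lambda>e x. (norm (\<phi> e x))\<^sup>2) \<in> rayleigh_quotients G L"
      unfolding rayleigh_quotients_def using \<phi>H1 nz mean by blast
    have "dirichlet_integral G L \<phi> / graph_integral G L (\<lambda>e x. (norm (\<phi> e x))\<^sup>2) \<le> (4 / l) / (l / 3)"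
      unfolding D using l N by (intro divide_left_mono) auto
    also have "\<dots> = 12 / (L b)\<^sup>2" by (simp add: l_def power2_eq_square)
    finally show "dirichlet_integral G L \<phi> / graph_integral G L (\<lambda>e x. (norm (\<phi> e x))\<^sup>2) \<le> 12 / (L b)\<^sup>2" .
  qed
qed

lemma mu1_le_bridge:
  assumes fin: "fin_digraph G" and con: "Digraph_Component.connected G" and b: "bridging_edge G b"
    and L: "\<And>e. e \<in> arcs G \<Longrightarrow> 0 < L e"
  shows "mu1 G L \<le> sqrt 3 * (total_length G L / L b)"
proof -
  have bG: "b \<in> arcs G" using b by (simp add: bridging_edge_def)
  have A: "0 \<le> total_length G L" unfolding total_length_def by (intro sum_nonneg less_imp_le L)
  obtain q where q: "q \<in> rayleigh_quotients G L" "q \<le> 12 / (L b)\<^sup>2"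
    using bridge_rayleigh_quotient[where G=G and L=L, OF fin con b L] by blast
  have "lambda2 G L \<le> q"
    unfolding lambda2_eq_Inf
    by (rule cInf_lower[OF q(1) bdd_belowI[where m=0]]) (rule rayleigh_quotient_nonneg)
  then have "lambda2 G L / 4 \<le> 3 / (L b)\<^sup>2" using q(2) by simp
  then have "sqrt (lambda2 G L / 4) \<le> sqrt (3 / (L b)\<^sup>2)"
    by (rule real_sqrt_le_mono)
  also have "\<dots> = sqrt 3 / L b"
    using L[OF bG] by (simp add: real_sqrt_divide)
  finally have "total_length G L * sqrt (lambda2 G L / 4) \<le> total_length G L * (sqrt 3 / L b)"
    using A by (rule mult_left_mono)
  then show ?thesis by (simp add: mu1_def mult.commute)
qed

theorem corollary2p6:
  fixes G :: "('v, 'e) pre_digraph"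
    and L :: "real \<Rightarrow> 'e \<Rightarrow> real"
    and b :: 'e
  assumes "fin_digraph G"
    and "Digraph_Component.connected G"
    and "\<nexists>e. terminal_edge G e"
    and "\<not> has_cycle_covering G"
    and "\<And>l e. l > 0 \<Longrightarrow> e \<in> arcs G \<Longrightarrow> L l e > 0"
    and "bridging_edge G b"
    and "\<And>l. l > 0 \<Longrightarrow> L l b = l"
    and "\<And>l l' e. l > 0 \<Longrightarrow> l' > 0 \<Longrightarrow> e \<in> arcs G \<Longrightarrow> \<not> bridging_edge G e \<Longrightarrow> L l e = L l' e"
    and "\<And>l e. l > 0 \<Longrightarrow> bridging_edge G e \<Longrightarrow> e \<noteq> b \<Longrightarrow> L l e \<le> l"
    and "\<exists>C. \<forall>l>0. \<forall>e. bridging_edge G e \<and> e \<noteq> b \<longrightarrow> L l e \<le> C"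
  shows "\<forall>\<^sub>F l in at_top.
           mu1 G (L l) < mu_R \<and>
           (\<forall>\<mu>\<in>{mu1 G (L l)<..mu_R}. \<forall>u. ground_state G (L l) \<mu> u \<longrightarrow> \<not> constant_on_graph G (L l) u)"
proof -
  have fin: "finite (arcs G)" using assms(1) by (simp add: fin_digraph.finite_arcs)
  have bG: "b \<in> arcs G" using assms(6) by (simp add: bridging_edge_def)
  obtain C where C: "\<And>l e. l > 0 \<Longrightarrow> bridging_edge G e \<Longrightarrow> e \<noteq> b \<Longrightarrow> L l e \<le> C"
    using assms(10) by blast
  \<comment> \<open>A bound, uniform in \<open>l\<close>, for the total length of the edges other than \<open>b\<close>.\<close>
  define K where "K = (\<Sum>e\<in>arcs G - {b}. if bridging_edge G e then C else L 1 e)"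
  have K: "total_length G (L l) \<le> l + K" if "l > 0" for l
  proof -
    have "(\<Sum>e\<in>arcs G - {b}. L l e) \<le> K"
      unfolding K_def using C[OF that] assms(8)[OF that, of 1] by (intro sum_mono) auto
    then show ?thesis
      unfolding total_length_def sum.remove[OF fin bG] using assms(7)[OF that] by simp
  qed
  \<comment> \<open>Then the total length is below \<open>3 / 2 * l\<close>, and \<open>3 / 2 < pi / 2\<close>.\<close>
  have "\<forall>\<^sub>F l in at_top. max 0 (2 * K) < l" by (rule eventually_gt_at_top)
  then show ?thesis
  proof eventually_elim
    case (elim l)
    then have l: "0 < l" "2 * K < l" by auto
    obtain q where "q \<in> rayleigh_quotients G (L l)"
      using bridge_rayleigh_quotient[where G=G and L="L l", OF assms(1,2,6) assms(5)[OF l(1)]] by blast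
    then have ne: "rayleigh_quotients G (L l) \<noteq> {}" by blast
    have "total_length G (L l) / l < 3 / 2"
      using K[OF l(1)] l by (simp add: pos_divide_less_eq)
    then have "total_length G (L l) / L l b < pi / 2"
      unfolding assms(7)[OF l(1)] using pi_gt3 by linarith
    then have "sqrt 3 * (total_length G (L l) / L l b) < sqrt 3 * (pi / 2)"
      by (intro mult_strict_left_mono) auto
    then have "mu1 G (L l) < mu_R"
      using mu1_le_bridge[where G=G and L="L l", OF assms(1,2,6) assms(5)[OF l(1)]] by (simp add: mu_R_def mult.commute)
    moreover have "\<not> constant_on_graph G (L l) u"
      if "\<mu> \<in> {mu1 G (L l)<..mu_R}" "ground_state G (L l) \<mu> u" for \<mu> u
      using constant_not_ground_state_above_mu1[where G=G and L="L l", OF fin assms(5)[OF l(1)] ne] that by auto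
    ultimately show ?case by blast
  qed
qed

end
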